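(* Let $\mathcal{H}$ be an infinite-dimensional complex Hilbert space and let $T\in\mathcal{B}(\mathcal{H})$ be such that every point of $\partial\sigma(T)$ is an eigenvalue of $T$ and every point of $\partial\sigma(T^* )$ is an eigenvalue of $T^*$. Then for any $\varepsilon>0$ there exists a finite rank operator $F\in\mathcal{B}(\mathcal{H})$ such that $\|F\|<\varepsilon$ and $T-F$ has an invariant closed subspace of infinite dimension and infinite codimension. Moreover, the rank of $F$ can be chosen independent of $\varepsilon$; that is, there is a nonnegative integer $r$ (depending only on $T$) such that for every $\varepsilon>0$ the operator $F$ can be chosen to have rank $r$.
   Context: $\mathcal{B}(\mathcal{H})$ is the algebra of bounded linear operators on $\mathcal{H}$; $T^*$ is the Hilbert space adjoint of $T$; $\sigma(T)$ is the spectrum of $T$ and $\partial\sigma(T)$ its topological boundary in $\mathbb{C}$. *)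

theory Defs
  imports "HOL-Analysis.Analysis"
begin

text \<open>
  Complex inner product spaces, built on top of the real inner product spaces of the library: the
  real inner product is the real part of the complex one, so that the norm and the topology
  inherited from \<^class>\<open>real_inner\<close> are those of the complex inner product.  The complex inner
  product is linear in the first argument; positivity and definiteness follow from
  \<open>inner_eq_Re_cinner\<close> and \<open>cinner_commute\<close>.
\<close>

class complex_inner = real_inner +
  fixes scaleC :: "complex \<Rightarrow> 'a \<Rightarrow> 'a" (infixr "*\<^sub>C" 75)
    and cinner :: "'a \<Rightarrow> 'a \<Rightarrow> complex"
  assumes scaleC_add_right: "a *\<^sub>C (x + y) = a *\<^sub>C x + a *\<^sub>C y"
    and scaleC_add_left: "(a + b) *\<^sub>C x = a *\<^sub>C x + b *\<^sub>C x"
    and scaleC_scaleC: "a *\<^sub>C b *\<^sub>C x = (a * b) *\<^sub>C x"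
    and scaleC_one: "1 *\<^sub>C x = x"
    and scaleR_scaleC: "r *\<^sub>R x = complex_of_real r *\<^sub>C x"
    and cinner_commute: "cinner x y = cnj (cinner y x)"
    and cinner_add_left: "cinner (x + y) z = cinner x z + cinner y z"
    and cinner_scaleC_left: "cinner (a *\<^sub>C x) y = a * cinner x y"
    and inner_eq_Re_cinner: "inner x y = Re (cinner x y)"

class chilbert_space = complex_inner + banach

instantiation complex :: chilbert_space
begin

definition scaleC_complex :: "complex \<Rightarrow> complex \<Rightarrow> complex"
  where "scaleC_complex a x = a * x"

definition cinner_complex :: "complex \<Rightarrow> complex \<Rightarrow> complex"
  where "cinner_complex x y = x * cnj y"

instance
  by standard
    (auto simp: scaleC_complex_def cinner_complex_def algebra_simps inner_complex_def
      scaleR_conv_of_real)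

end

lemma norm_eq_sqrt_cinner: "norm x = sqrt (Re (cinner x x))"
  by (simp add: norm_eq_sqrt_inner inner_eq_Re_cinner)

global_interpretation complex_vector: vector_space "scaleC :: complex \<Rightarrow> 'a \<Rightarrow> 'a::complex_inner"
  defines csubspace = complex_vector.subspace
    and cspan = complex_vector.span
    and cdim = complex_vector.dim
  by standard (simp_all add: scaleC_add_right scaleC_add_left scaleC_scaleC scaleC_one)

locale bounded_clinear = bounded_linear f
  for f :: "'a::complex_inner \<Rightarrow> 'b::complex_inner" +
  assumes scaleC: "f (a *\<^sub>C x) = a *\<^sub>C f x"

definition cfinite_dim :: "'a::complex_inner set \<Rightarrow> bool"
  where "cfinite_dim M \<longleftrightarrow> (\<exists>B. finite B \<and> M \<subseteq> cspan B)"

text \<open>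
  The quotient by the subspace \<open>M\<close> is finite-dimensional, i.e. it is spanned by the cosets of
  finitely many vectors.
\<close>

definition cfinite_codim :: "'a::complex_inner set \<Rightarrow> bool"
  where "cfinite_codim M \<longleftrightarrow> (\<exists>B. finite B \<and> cspan (M \<union> B) = UNIV)"

definition finite_rank :: "('a::complex_inner \<Rightarrow> 'b::complex_inner) \<Rightarrow> bool"
  where "finite_rank F \<longleftrightarrow> cfinite_dim (range F)"

text \<open>Meaningful only together with \<open>finite_rank F\<close>, as \<open>cdim\<close> is a natural number.\<close>

definition op_rank :: "('a::complex_inner \<Rightarrow> 'b::complex_inner) \<Rightarrow> nat"
  where "op_rank F = cdim (range F)"

text \<open>For bounded complex-linear \<open>T\<close>, existence of the adjoint is the Riesz representation theorem.\<close>

definition cadjoint :: "('a::chilbert_space \<Rightarrow> 'b::chilbert_space) \<Rightarrow> 'b \<Rightarrow> 'a"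
  where "cadjoint T = (THE S. \<forall>x y. cinner (T x) y = cinner x (S y))"

definition op_invertible :: "('a::complex_inner \<Rightarrow> 'a) \<Rightarrow> bool"
  where "op_invertible T \<longleftrightarrow> (\<exists>S. bounded_clinear S \<and> S \<circ> T = id \<and> T \<circ> S = id)"

definition op_spectrum :: "('a::complex_inner \<Rightarrow> 'a) \<Rightarrow> complex set"
  where "op_spectrum T = {z. \<not> op_invertible (\<lambda>x. T x - z *\<^sub>C x)}"

definition op_eigenvalue :: "('a::complex_inner \<Rightarrow> 'a) \<Rightarrow> complex \<Rightarrow> bool"
  where "op_eigenvalue T z \<longleftrightarrow> (\<exists>x. x \<noteq> 0 \<and> T x = z *\<^sub>C x)"

definition op_invariant :: "('a \<Rightarrow> 'a) \<Rightarrow> 'a set \<Rightarrow> bool"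
  where "op_invariant T M \<longleftrightarrow> (\<forall>x\<in>M. T x \<in> M)"

end

theory Submission
  imports Defs "HOL-Complex_Analysis.Conformal_Mappings"
begin

text \<open>
  Write \<open>E\<close> for the set of \<open>z\<close> such that \<open>z\<close> is an eigenvalue of \<open>T\<close> and its conjugate one of
  \<open>T\<^sup>*\<close>.  Eigenvectors of \<open>T\<close> and \<open>T\<^sup>*\<close> for non-conjugate eigenvalues are orthogonal, so if \<open>E\<close> is
  infinite, half of it yields an invariant half-space; so does an infinite-dimensional eigenspace.
  Otherwise the spectrum has finite boundary and is finite.  If the resolvent had only poles, \<open>T\<close>
  would be algebraic by Liouville's theorem and hence have an infinite-dimensional eigenspace, so
  some \<open>\<zeta>\<close> is an essential singularity of the resolvent.  Small rank-one operators from
  \<open>ker (T - \<zeta>)\<close> to \<open>ker ((T - \<zeta>)\<^sup>*)\<close> shrink both kernels without destroying the essential singularity,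
  until one of them is trivial, say the first.  Then there are \<open>\<mu> n \<longlonglongrightarrow> \<zeta>\<close> and \<open>e\<close> such that
  \<open>h n = (T - \<mu> n)\<^sup>-\<^sup>1 e\<close> is unbounded and, normalised, weakly null.  Hence some small \<open>w\<close> satisfies
  \<open>\<langle>h n, w\<rangle> = 1\<close> infinitely often, and subtracting \<open>x \<mapsto> \<langle>x, w\<rangle> e\<close> makes each such \<open>\<mu> n\<close> an element of
  \<open>E\<close>.  The ranks are bounded independently of \<open>\<epsilon>\<close>, so one of them occurs for arbitrarily small \<open>\<epsilon>\<close>.
\<close>

subsection \<open>Complex inner products\<close>

text \<open>One rank-one operator has to create infinitely many joint eigenvalues at once, which
  requires points outside the spectrum along which the resolvent blows up. The obstacle is the
  kernel of \<open>T - \<zeta>\<close>: every weak limit of the normalised \<open>h n\<close> along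
  indices with \<open>norm (h n)\<close> tending to infinity lies in it. A trivial kernel makes the
  range of the adjoint of \<open>T - \<zeta>\<close> dense, and weak nullity follows; by symmetry a
  trivial kernel of the adjoint serves as well. Shrinking kernels may move the spectrum near
  \<zeta>, so invertibility is protected only along one fixed sequence, by avoiding countably many
  scaling factors. Being no pole survives because rank-one perturbations preserve poles and can be
  undone, and it implies blow-up because a bound along the sequence would spread to a neighbourhood.
  The kernel may be taken finite-dimensional, since otherwise an eigenspace already yields the
  half-space; this is what bounds the rank.\<close>

lemma scaleC_minus_one [simp]: "(-1) *\<^sub>C x = - (x :: 'a::complex_inner)"
  using complex_vector.scale_minus_left[of 1 x] by (simp add: scaleC_one)

lemma cinner_zero_left [simp]: "cinner 0 y = 0"
  using cinner_add_left[of 0 0 y] by simp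

lemma cinner_zero_right [simp]: "cinner x 0 = 0"
  using cinner_commute[of x 0] by simp

lemma cinner_minus_left: "cinner (- x) y = - cinner x y"
  using cinner_scaleC_left[of "-1" x y] by simp

lemma cinner_diff_left: "cinner (x - y) z = cinner x z - cinner y z"
  using cinner_add_left[of x "- y" z] by (simp add: cinner_minus_left)

lemma cinner_add_right: "cinner x (y + z) = cinner x y + cinner x z"
  by (metis cinner_add_left cinner_commute complex_cnj_add)

lemma cinner_scaleC_right: "cinner x (a *\<^sub>C y) = cnj a * cinner x y"
  by (metis cinner_scaleC_left cinner_commute complex_cnj_mult)

lemma cinner_minus_right: "cinner x (- y) = - cinner x y"
  using cinner_scaleC_right[of x "-1" y] by simp

lemma cinner_diff_right: "cinner x (y - z) = cinner x y - cinner x z"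
  using cinner_add_right[of x y "- z"] by (simp add: cinner_minus_right)

lemmas cinner_simps = cinner_add_left cinner_add_right cinner_diff_left cinner_diff_right
  cinner_scaleC_left cinner_scaleC_right cinner_minus_left cinner_minus_right

lemma cinner_same: "cinner x x = complex_of_real ((norm x)\<^sup>2)"
proof (rule complex_eqI)
  show "Re (cinner x x) = Re (complex_of_real ((norm x)\<^sup>2))"
    by (simp add: norm_eq_sqrt_cinner flip: inner_eq_Re_cinner)
  have "cinner x x = cnj (cinner x x)" by (rule cinner_commute)
  then have "Im (cinner x x) = - Im (cinner x x)" by (metis cnj.simps(2))
  then show "Im (cinner x x) = Im (complex_of_real ((norm x)\<^sup>2))" by simp
qed

lemma cinner_same_eq_0_iff [simp]: "cinner x x = 0 \<longleftrightarrow> x = 0"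
  by (simp add: cinner_same)

lemma cinner_eq_0_commute: "cinner x y = 0 \<longleftrightarrow> cinner y x = 0"
  using cinner_commute[of x y] by simp

lemma cinner_ext_right: "(\<And>x. cinner x y = cinner x y') \<Longrightarrow> y = y'"
  using cinner_same_eq_0_iff[of "y - y'"] by (simp add: cinner_diff_right)

lemma norm_scaleC [simp]: "norm (a *\<^sub>C x) = cmod a * norm (x :: 'a::complex_inner)"
proof -
  have "complex_of_real ((norm (a *\<^sub>C x))\<^sup>2) = complex_of_real ((cmod a * norm x)\<^sup>2)"
    unfolding cinner_same[symmetric] cinner_scaleC_left cinner_scaleC_right
    by (simp add: cinner_same power_mult_distrib complex_norm_square del: of_real_power)
  then have "(norm (a *\<^sub>C x))\<^sup>2 = (cmod a * norm x)\<^sup>2" by (simp only: of_real_eq_iff)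
  then show ?thesis by (simp add: power2_eq_iff_nonneg)
qed

lemma norm_cinner_le: "cmod (cinner x y) \<le> norm x * norm y"
proof (cases "cinner x y = 0")
  case False
  define a where "a = cnj (cinner x y) / cmod (cinner x y)"
  have "a * cinner x y = cmod (cinner x y)"
    using False by (simp add: a_def complex_norm_square[symmetric] power2_eq_square mult.commute)
  then have "cmod (cinner x y) = inner (a *\<^sub>C x) y"
    by (simp add: inner_eq_Re_cinner cinner_scaleC_left)
  also have "\<dots> \<le> norm (a *\<^sub>C x) * norm y" by (rule norm_cauchy_schwarz)
  also have "norm (a *\<^sub>C x) = norm x" using False by (simp add: a_def norm_divide)
  finally show ?thesis .
qed simp

lemma bounded_bilinear_cinner: "bounded_bilinear cinner"
proof
  show "\<exists>K. \<forall>a b. norm (cinner a b) \<le> norm a * norm b * K"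
    by (intro exI[of _ 1]) (simp add: norm_cinner_le)
qed (simp_all add: cinner_simps scaleR_scaleC, simp_all add: scaleC_complex_def)

lemma bounded_bilinear_scaleC: "bounded_bilinear (scaleC :: complex \<Rightarrow> 'a \<Rightarrow> 'a::complex_inner)"
proof
  show "\<exists>K. \<forall>a b. norm (a *\<^sub>C (b::'a)) \<le> norm a * norm b * K"
    by (intro exI[of _ 1]) simp
qed (simp_all add: scaleC_add_left scaleC_add_right scaleR_scaleC scaleC_scaleC
      scaleC_complex_def mult.commute)

lemmas tendsto_cinner = bounded_bilinear.tendsto[OF bounded_bilinear_cinner]
lemmas continuous_on_cinner = bounded_bilinear.continuous_on[OF bounded_bilinear_cinner]
lemmas tendsto_scaleC = bounded_bilinear.tendsto[OF bounded_bilinear_scaleC]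

section \<open>Orthogonality and nearest points\<close>

lemma norm_add_orthogonal:
  assumes "cinner x y = 0"
  shows "(norm (x + y))\<^sup>2 = (norm x)\<^sup>2 + (norm y)\<^sup>2"
proof -
  have "inner x y = 0" using assms by (simp add: inner_eq_Re_cinner)
  then show ?thesis
    by (simp add: power2_norm_eq_inner inner_add_left inner_add_right inner_commute)
qed

lemma closure_csubspace:
  assumes "csubspace M"
  shows "csubspace (closure M)"
proof (rule complex_vector.subspaceI)
  show "0 \<in> closure M"
    using assms complex_vector.subspace_0 closure_subset by blast
next
  fix x y assume "x \<in> closure M" "y \<in> closure M"
  then obtain f g where "\<And>n. f n \<in> M" "f \<longlonglongrightarrow> x" "\<And>n. g n \<in> M" "g \<longlonglongrightarrow> y"
    unfolding closure_sequential by blast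
  then have "\<forall>n. f n + g n \<in> M" "(\<lambda>n. f n + g n) \<longlonglongrightarrow> x + y"
    using assms by (auto intro: tendsto_add complex_vector.subspace_add)
  then show "x + y \<in> closure M" unfolding closure_sequential
    by (intro exI[of _ "\<lambda>n. f n + g n"]) auto
next
  fix c x assume "x \<in> closure M"
  then obtain f where "\<And>n. f n \<in> M" "f \<longlonglongrightarrow> x"
    unfolding closure_sequential by blast
  then have "\<forall>n. c *\<^sub>C f n \<in> M" "(\<lambda>n. c *\<^sub>C f n) \<longlonglongrightarrow> c *\<^sub>C x"
    using assms by (auto intro: tendsto_scaleC complex_vector.subspace_scale)
  then show "c *\<^sub>C x \<in> closure M" unfolding closure_sequential
    by (intro exI[of _ "\<lambda>n. c *\<^sub>C f n"]) auto
qed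

lemma csubspace_orthogonal: "csubspace {v. cinner v y = 0}"
  by (rule complex_vector.subspaceI) (auto simp: cinner_simps)

lemma orthogonal_cspan:
  assumes "\<And>x. x \<in> X \<Longrightarrow> cinner x y = 0" and "v \<in> cspan X"
  shows "cinner v y = 0"
  using complex_vector.span_minimal[OF _ csubspace_orthogonal, of X y] assms by auto

text \<open>The parallelogram law makes a minimising sequence Cauchy: the midpoint of two terms lies
  in \<open>M\<close>, so it is no closer to \<open>x\<close> than \<open>d\<close>, which forces
  the terms together.\<close>

lemma ex_nearest_point:
  fixes M :: "'a::chilbert_space set"
  assumes M: "csubspace M" "closed M"
  shows "\<exists>m\<in>M. \<forall>v\<in>M. norm (x - m) \<le> norm (x - v)"
proof -
  define d where "d = infdist x M"
  have ne: "M \<noteq> {}" using complex_vector.subspace_0[OF M(1)] by auto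
  have dle: "d \<le> norm (x - v)" if "v \<in> M" for v
    using infdist_le[OF that, of x] by (simp add: d_def dist_norm)
  have d0: "d \<ge> 0" by (simp add: d_def infdist_nonneg)
  have "\<exists>v\<in>M. norm (x - v) < d + inverse (real (Suc n))" for n
  proof (rule ccontr)
    assume "\<not> ?thesis"
    then have "d + inverse (real (Suc n)) \<le> infdist x M"
      using ne by (subst infdist_notempty[OF ne]) (auto intro!: cINF_greatest simp: dist_norm not_less)
    then show False by (simp add: d_def)
  qed
  then obtain f where f: "\<And>n. f n \<in> M" "\<And>n. norm (x - f n) < d + inverse (real (Suc n))"
    by metis
  have lim: "(\<lambda>n. norm (x - f n)) \<longlonglongrightarrow> d"
  proof (rule real_tendsto_sandwich[where f = "\<lambda>_. d"])
    show "(\<lambda>n. d + inverse (real (Suc n))) \<longlonglongrightarrow> d"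
      using tendsto_add[OF tendsto_const LIMSEQ_inverse_real_of_nat, of d] by simp
    show "\<forall>\<^sub>F n in sequentially. d \<le> norm (x - f n)" using dle f(1) by simp
    show "\<forall>\<^sub>F n in sequentially. norm (x - f n) \<le> d + inverse (real (Suc n))"
      using f(2) less_imp_le by (intro always_eventually) blast
  qed simp
  have "Cauchy f"
  proof (rule CauchyI)
    fix e :: real assume "e > 0"
    have "(\<lambda>n. (norm (x - f n))\<^sup>2) \<longlonglongrightarrow> d\<^sup>2" using lim by (rule tendsto_power)
    then have "\<forall>\<^sub>F n in sequentially. (norm (x - f n))\<^sup>2 < d\<^sup>2 + e\<^sup>2 / 4"
      using \<open>e > 0\<close> by (intro order_tendstoD(2)) auto
    then obtain N where N: "\<And>n. n \<ge> N \<Longrightarrow> (norm (x - f n))\<^sup>2 < d\<^sup>2 + e\<^sup>2 / 4"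
      by (auto simp: eventually_sequentially)
    have "norm (f i - f j) < e" if "i \<ge> N" "j \<ge> N" for i j
    proof -
      let ?m = "(1/2) *\<^sub>R (f i + f j)"
      have "?m \<in> M" unfolding scaleR_scaleC
        using M(1) f(1) by (intro complex_vector.subspace_scale complex_vector.subspace_add)
      then have "d\<^sup>2 \<le> (norm (x - ?m))\<^sup>2" using dle d0 by (simp add: power_mono)
      moreover have "(norm (f i - f j))\<^sup>2 + 4 * (norm (x - ?m))\<^sup>2
        = 2 * (norm (x - f i))\<^sup>2 + 2 * (norm (x - f j))\<^sup>2"
        unfolding power2_norm_eq_inner
        by (simp add: inner_simps inner_commute algebra_simps)
      ultimately have "(norm (f i - f j))\<^sup>2 < e\<^sup>2"
        using N[OF that(1)] N[OF that(2)] by linarith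
      then show ?thesis using \<open>e > 0\<close> by (simp add: power2_less_imp_less)
    qed
    then show "\<exists>N. \<forall>m\<ge>N. \<forall>n\<ge>N. norm (f m - f n) < e" by blast
  qed
  then obtain m where m: "f \<longlonglongrightarrow> m"
    using Cauchy_convergent convergent_def by blast
  then have "m \<in> M" using M(2) f(1) closed_sequentially by blast
  moreover have "norm (x - m) = d"
    using lim by (rule LIMSEQ_unique[rotated]) (intro tendsto_intros m)
  ultimately show ?thesis using dle by auto
qed

lemma ex_orthogonal_vector:
  fixes M :: "'a::chilbert_space set"
  assumes M: "csubspace M" "closed M" and "M \<noteq> UNIV"
  shows "\<exists>z. z \<noteq> 0 \<and> (\<forall>v\<in>M. cinner v z = 0)"
proof -
  obtain x where x: "x \<notin> M" using \<open>M \<noteq> UNIV\<close> by auto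
  obtain m where m: "m \<in> M" "\<And>v. v \<in> M \<Longrightarrow> norm (x - m) \<le> norm (x - v)"
    using ex_nearest_point[OF M] by blast
  have "cinner v (x - m) = 0" if v: "v \<in> M" for v
  proof (cases "v = 0")
    case False
    \<comment> \<open>Coefficient of the orthogonal projection of \<open>x - m\<close> onto
      \<open>v\<close>; by Pythagoras a nonzero \<open>t\<close> would put \<open>m + t v\<close>
      strictly closer to \<open>x\<close> than \<open>m\<close>.\<close>
    define t where "t = cinner (x - m) v / (norm v)\<^sup>2"
    have "m + t *\<^sub>C v \<in> M"
      using M(1) m(1) v by (intro complex_vector.subspace_add complex_vector.subspace_scale)
    then have "norm (x - m) \<le> norm (x - m - t *\<^sub>C v)" using m(2) by (simp add: algebra_simps)
    moreover have "cinner (x - m - t *\<^sub>C v) (t *\<^sub>C v) = 0"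
      using False by (simp add: cinner_simps t_def cinner_same)
    then have "(norm (x - m))\<^sup>2 = (norm (x - m - t *\<^sub>C v))\<^sup>2 + (norm (t *\<^sub>C v))\<^sup>2"
      using norm_add_orthogonal by fastforce
    ultimately have "norm (t *\<^sub>C v) = 0"
      by (smt (verit) norm_ge_zero power_mono zero_less_power2)
    then have "t = 0" using False by simp
    then have "cinner (x - m) v = 0" using False by (simp add: t_def)
    then show ?thesis by (simp add: cinner_eq_0_commute)
  qed simp
  then show ?thesis using m(1) x by (intro exI[of _ "x - m"]) auto
qed

subsection \<open>Bounded operators and adjoints\<close>

lemma bounded_clinearI:
  assumes "\<And>x y. f (x + y) = f x + f y" "\<And>a x. f (a *\<^sub>C x) = a *\<^sub>C f x"
    and "\<And>x. norm (f x) \<le> norm x * K"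
  shows "bounded_clinear f"
proof -
  have "bounded_linear f"
    by (rule bounded_linear_intro[where K = K]) (use assms in \<open>simp_all add: scaleR_scaleC\<close>)
  then show ?thesis
    by (simp add: bounded_clinear_def bounded_clinear_axioms_def assms(2))
qed

lemma bounded_clinear_imp_bounded_linear: "bounded_clinear f \<Longrightarrow> bounded_linear f"
  by (simp add: bounded_clinear_def)

lemma bounded_clinear_scale: "bounded_clinear f \<Longrightarrow> f (a *\<^sub>C x) = a *\<^sub>C f x"
  by (rule bounded_clinear.scaleC)

lemma bounded_clinear_add_apply: "bounded_clinear f \<Longrightarrow> f (x + y) = f x + f y"
  by (simp add: bounded_clinear_imp_bounded_linear linear_simps(1))

lemma bounded_clinear_diff_apply: "bounded_clinear f \<Longrightarrow> f (x - y) = f x - f y"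
  by (simp add: bounded_clinear_imp_bounded_linear linear_simps(2))

lemma bounded_clinear_zero_apply: "bounded_clinear f \<Longrightarrow> f 0 = 0"
  by (simp add: bounded_clinear_imp_bounded_linear linear_simps(3))

lemma bounded_clinear_scaleC_id: "bounded_clinear (\<lambda>x. a *\<^sub>C x)"
  by (rule bounded_clinearI[where K = "cmod a"])
    (simp_all add: scaleC_add_right scaleC_scaleC mult.commute)

lemma bounded_clinear_zero: "bounded_clinear (\<lambda>x. 0)"
  by (rule bounded_clinearI[where K = 0]) simp_all

lemma bounded_clinear_add:
  assumes "bounded_clinear f" "bounded_clinear g"
  shows "bounded_clinear (\<lambda>x. f x + g x)"
  using bounded_linear_add[OF assms[THEN bounded_clinear_imp_bounded_linear]] assms
  by (simp add: bounded_clinear_def bounded_clinear_axioms_def scaleC_add_right)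

lemma bounded_clinear_diff:
  assumes "bounded_clinear f" "bounded_clinear g"
  shows "bounded_clinear (\<lambda>x. f x - g x)"
  using bounded_linear_sub[OF assms[THEN bounded_clinear_imp_bounded_linear]] assms
  by (simp add: bounded_clinear_def bounded_clinear_axioms_def complex_vector.scale_right_diff_distrib)

lemma bounded_clinear_compose:
  assumes "bounded_clinear f" "bounded_clinear g"
  shows "bounded_clinear (\<lambda>x. f (g x))"
  using bounded_linear_compose[OF assms[THEN bounded_clinear_imp_bounded_linear]] assms
  by (simp add: bounded_clinear_def bounded_clinear_axioms_def)

lemma bounded_clinear_shift: "bounded_clinear T \<Longrightarrow> bounded_clinear (\<lambda>x. T x - z *\<^sub>C x)"
  by (rule bounded_clinear_diff[OF _ bounded_clinear_scaleC_id])

definition rank_one :: "'a::complex_inner \<Rightarrow> 'a \<Rightarrow> 'a \<Rightarrow> 'a"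
  where "rank_one g k x = cinner x k *\<^sub>C g"

lemma norm_rank_one_le: "norm (rank_one g k x) \<le> norm g * norm k * norm x"
  using mult_right_mono[OF norm_cinner_le[of x k] norm_ge_zero[of g]]
  by (simp add: rank_one_def mult_ac)

lemma bounded_clinear_rank_one: "bounded_clinear (rank_one g k)"
  using norm_rank_one_le[of g k]
  by (intro bounded_clinearI[where K = "norm g * norm k"])
    (simp_all add: rank_one_def cinner_simps scaleC_add_left scaleC_scaleC mult_ac)

section \<open>Riesz representation and adjoints\<close>

lemma Riesz_representation:
  fixes f :: "'a::chilbert_space \<Rightarrow> complex"
  assumes f: "bounded_clinear f"
  shows "\<exists>z. \<forall>x. f x = cinner x z"
proof (cases "\<forall>x. f x = 0")
  case True
  then show ?thesis by (intro exI[of _ 0]) simp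
next
  case False
  let ?M = "{x. f x = 0}"
  have "csubspace ?M"
    by (rule complex_vector.subspaceI)
      (simp_all add: bounded_clinear_add_apply[OF f] bounded_clinear_scale[OF f]
        bounded_clinear_zero_apply[OF f])
  moreover have "closed ?M"
    by (intro closed_Collect_eq bounded_linear.continuous_on[OF bounded_clinear_imp_bounded_linear[OF f]]
        continuous_intros)
  ultimately obtain z where z: "z \<noteq> 0" "\<And>v. f v = 0 \<Longrightarrow> cinner v z = 0"
    using ex_orthogonal_vector[of ?M] False by blast
  have fz: "f z \<noteq> 0" using z(2)[of z] z(1) by auto
  \<comment> \<open>Every \<open>x\<close> is a multiple of \<open>z\<close> plus a vector of the
    kernel of \<open>f\<close>, to which \<open>z\<close> is orthogonal; the scalar makes both sides
    agree at \<open>z\<close>.\<close>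
  have "f x = cinner x ((cnj (f z) / (norm z)\<^sup>2) *\<^sub>C z)" for x
  proof -
    have "f (x - (f x / f z) *\<^sub>C z) = 0"
      using fz by (simp add: bounded_clinear_diff_apply[OF f] bounded_clinear_scale[OF f])
        (simp add: scaleC_complex_def)
    then have "cinner x z = f x / f z * (norm z)\<^sup>2"
      using z(2) by (fastforce simp: cinner_simps cinner_same)
    then show ?thesis using fz z(1) by (simp add: cinner_simps)
  qed
  then show ?thesis by blast
qed

text \<open>A relation replaces \<open>cadjoint\<close> because it is symmetric and passes directly
  to sums, differences, shifts and rank-one operators, so that perturbed operators carry their
  adjoints along.\<close>

definition is_adjoint :: "('a::complex_inner \<Rightarrow> 'a) \<Rightarrow> ('a \<Rightarrow> 'a) \<Rightarrow> bool"
  where "is_adjoint T S \<longleftrightarrow> bounded_clinear T \<and> bounded_clinear S \<and>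
    (\<forall>x y. cinner (T x) y = cinner x (S y))"

lemma is_adjointD:
  assumes "is_adjoint T S"
  shows "bounded_clinear T" "bounded_clinear S" "cinner (T x) y = cinner x (S y)"
    "cinner (S x) y = cinner x (T y)"
  using assms unfolding is_adjoint_def by (blast, blast, blast, metis cinner_commute)

lemma is_adjoint_sym: "is_adjoint T S \<Longrightarrow> is_adjoint S T"
  using is_adjointD[of T S] unfolding is_adjoint_def by blast

lemma ex_adjoint:
  fixes T :: "'a::chilbert_space \<Rightarrow> 'a"
  assumes T: "bounded_clinear T"
  shows "\<exists>S. is_adjoint T S"
proof -
  obtain K where K: "\<And>x. norm (T x) \<le> norm x * K" "K > 0"
    using bounded_linear.pos_bounded[OF bounded_clinear_imp_bounded_linear[OF T]] by blast
  have "\<exists>z. \<forall>x. cinner (T x) y = cinner x z" for y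
  proof (rule Riesz_representation)
    have "cmod (cinner (T x) y) \<le> norm x * (K * norm y)" for x
      using order_trans[OF norm_cinner_le mult_right_mono[OF K(1) norm_ge_zero], of x y]
      by (simp add: mult_ac)
    then show "bounded_clinear (\<lambda>x. cinner (T x) y)"
      by (rule bounded_clinearI[rotated 2])
       (simp_all add: bounded_clinear_add_apply[OF T] bounded_clinear_scale[OF T] cinner_simps,
         simp add: scaleC_complex_def)
  qed
  then obtain S where S: "\<And>x y. cinner (T x) y = cinner x (S y)" by metis
  have "bounded_clinear S"
  proof (rule bounded_clinearI[where K = K])
    show "S (x + y) = S x + S y" for x y
      by (rule cinner_ext_right) (simp add: cinner_simps flip: S)
    show "S (a *\<^sub>C x) = a *\<^sub>C S x" for a x
      by (rule cinner_ext_right) (simp add: cinner_simps flip: S)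
    show "norm (S x) \<le> norm x * K" for x
    proof (cases "S x = 0")
      case False
      have "(norm (S x))\<^sup>2 = cmod (cinner (T (S x)) x)"
        unfolding S cinner_same by (simp add: norm_power)
      also have "\<dots> \<le> norm (T (S x)) * norm x" by (rule norm_cinner_le)
      also have "\<dots> \<le> norm (S x) * K * norm x" by (intro mult_right_mono K(1)) simp
      finally show ?thesis using False by (simp add: power2_eq_square mult_ac)
    qed (use K(2) in simp)
  qed
  with S T show ?thesis by (auto simp: is_adjoint_def)
qed

lemma cadjoint_eq: "is_adjoint T S \<Longrightarrow> cadjoint T = S"
  unfolding cadjoint_def
proof (rule the_equality)
  fix S' assume TS: "is_adjoint T S" and "\<forall>x y. cinner (T x) y = cinner x (S' y)"
  then have "cinner x (S' y) = cinner x (S y)" for x y using is_adjointD(3)[OF TS, of x y] by simp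
  then show "S' = S" by (blast intro: cinner_ext_right)
qed (blast dest: is_adjointD(3))

lemma is_adjoint_diff:
  "is_adjoint T S \<Longrightarrow> is_adjoint F G \<Longrightarrow> is_adjoint (\<lambda>x. T x - F x) (\<lambda>x. S x - G x)"
  by (simp add: is_adjoint_def bounded_clinear_diff cinner_simps)

lemma is_adjoint_add:
  "is_adjoint T S \<Longrightarrow> is_adjoint F G \<Longrightarrow> is_adjoint (\<lambda>x. T x + F x) (\<lambda>x. S x + G x)"
  by (simp add: is_adjoint_def bounded_clinear_add cinner_simps)

lemma is_adjoint_shift:
  "is_adjoint T S \<Longrightarrow> is_adjoint (\<lambda>x. T x - z *\<^sub>C x) (\<lambda>x. S x - cnj z *\<^sub>C x)"
  by (simp add: is_adjoint_def bounded_clinear_shift cinner_simps)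

lemma is_adjoint_rank_one: "is_adjoint (rank_one g k) (rank_one k g)"
  unfolding is_adjoint_def
proof (intro conjI allI)
  show "cinner (rank_one g k x) y = cinner x (rank_one k g y)" for x y
    using cinner_commute[of g y] by (simp add: rank_one_def cinner_simps)
qed (rule bounded_clinear_rank_one)+

subsection \<open>Invertible operators and the spectrum\<close>

lemma op_invertibleE:
  assumes "op_invertible A"
  obtains S C where "bounded_clinear S" "\<And>x. S (A x) = x" "\<And>x. A (S x) = x"
    "C > 0" "\<And>x. norm (S x) \<le> C * norm x" "\<And>x. norm x \<le> C * norm (A x)"
proof -
  obtain S where S: "bounded_clinear S" "S \<circ> A = id" "A \<circ> S = id"
    using assms by (auto simp: op_invertible_def)
  obtain C where C: "\<And>x. norm (S x) \<le> norm x * C" "C > 0"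
    using bounded_linear.pos_bounded[OF bounded_clinear_imp_bounded_linear[OF S(1)]] by blast
  show ?thesis
  proof (rule that)
    show SA: "S (A x) = x" for x using S(2) by (simp add: fun_eq_iff)
    show "norm x \<le> C * norm (A x)" for x using C(1)[of "A x"] by (simp add: SA mult.commute)
  qed (use S C in \<open>simp_all add: fun_eq_iff mult.commute\<close>)
qed

lemma op_invertibleI:
  assumes A: "bounded_clinear A" and "surj A" and C: "\<And>x. norm x \<le> C * norm (A x)"
  shows "op_invertible A"
proof -
  have "inj A"
  proof (rule injI)
    fix x y assume "A x = A y"
    then show "x = y" using C[of "x - y"] by (simp add: bounded_clinear_diff_apply[OF A])
  qed
  let ?S = "inv A"
  have AS: "A (?S y) = y" for y using \<open>surj A\<close> by (simp add: surj_f_inv_f)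
  have "bounded_clinear ?S"
  proof (rule bounded_clinearI[where K = C])
    show "?S (x + y) = ?S x + ?S y" for x y
      by (rule injD[OF \<open>inj A\<close>]) (simp add: bounded_clinear_add_apply[OF A] AS)
    show "?S (a *\<^sub>C x) = a *\<^sub>C ?S x" for a x
      by (rule injD[OF \<open>inj A\<close>]) (simp add: bounded_clinear_scale[OF A] AS)
    show "norm (?S x) \<le> norm x * C" for x
      using C[of "?S x"] by (simp add: AS mult.commute)
  qed
  then show ?thesis
    unfolding op_invertible_def using \<open>inj A\<close> AS by (intro exI[of _ ?S]) (auto simp: fun_eq_iff)
qed

lemma op_invertible_adjoint:
  fixes A :: "'a::chilbert_space \<Rightarrow> 'a"
  assumes AB: "is_adjoint A B" and "op_invertible A"
  shows "op_invertible B"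
proof -
  obtain S where S: "bounded_clinear S" "\<And>x. S (A x) = x" "\<And>x. A (S x) = x"
    using op_invertibleE[OF assms(2)] by metis
  obtain S' where S': "is_adjoint S S'" using ex_adjoint[OF S(1)] ..
  have "S' (B y) = y" "B (S' y) = y" for y
    by (rule cinner_ext_right, simp add: S flip: is_adjointD(3)[OF S'] is_adjointD(3)[OF AB])+
  then show ?thesis
    unfolding op_invertible_def using is_adjointD(2)[OF S'] by (intro exI[of _ S']) auto
qed

text \<open>Banach's fixed-point theorem stands in for a Neumann series: solving
  \<open>A x - K x = y\<close> means finding a fixed point of the map from \<open>x\<close> to
  \<open>S (y + K x)\<close>, a contraction with factor 1/2. The lower bound loses a factor 2
  because \<open>K\<close> absorbs at most half of \<open>norm x\<close>.\<close>

lemma op_invertible_perturb: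
  fixes A :: "'a::chilbert_space \<Rightarrow> 'a"
  assumes A: "bounded_clinear A" "op_invertible A" and "C \<ge> 0"
    and C: "\<And>x. norm x \<le> C * norm (A x)"
    and K: "bounded_clinear K" "\<And>x. C * norm (K x) \<le> norm x / 2"
  shows "op_invertible (\<lambda>x. A x - K x)" "norm x \<le> 2 * C * norm (A x - K x)"
proof -
  have low: "norm x \<le> 2 * C * norm (A x - K x)" for x
  proof -
    have "C * norm (A x) \<le> C * (norm (A x - K x) + norm (K x))"
      using \<open>C \<ge> 0\<close> by (intro mult_left_mono norm_triangle_sub) (simp add: norm_triangle_sub add.commute)
    then show ?thesis using C[of x] K(2)[of x] by (simp add: algebra_simps)
  qed
  show "norm x \<le> 2 * C * norm (A x - K x)" by (rule low)
  obtain S where S: "bounded_clinear S" "\<And>x. S (A x) = x" "\<And>x. A (S x) = x"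
    using op_invertibleE[OF A(2)] by metis
  have "\<exists>x. y = A x - K x" for y
  proof -
    have "dist (S (y + K x)) (S (y + K x')) \<le> 1/2 * dist x x'" for x x'
    proof -
      have "S (y + K x) - S (y + K x') = S (K (x - x'))"
        by (simp add: bounded_clinear_diff_apply[OF K(1)] flip: bounded_clinear_diff_apply[OF S(1)])
      then show ?thesis
        using C[of "S (K (x - x'))"] K(2)[of "x - x'"] by (simp add: dist_norm S)
    qed
    then obtain x where "S (y + K x) = x"
      using banach_fix_type[of "1/2" "\<lambda>x. S (y + K x)"] by auto
    then have "A x = y + K x" using S(3) by metis
    then show ?thesis by (intro exI[of _ x]) simp
  qed
  then have "surj (\<lambda>x. A x - K x)" by (auto simp: surj_def)
  then show "op_invertible (\<lambda>x. A x - K x)"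
    by (rule op_invertibleI[OF bounded_clinear_diff[OF A(1) K(1)] _ low])
qed

text \<open>Moving the spectral parameter is a perturbation by a scalar operator. The radius depends
  only on \<open>C\<close>; this is what later turns bounds along a sequence into bounds near its
  limit.\<close>

lemma resolvent_nearby:
  fixes T :: "'a::chilbert_space \<Rightarrow> 'a"
  assumes T: "bounded_clinear T" and inv: "op_invertible (\<lambda>x. T x - \<mu> *\<^sub>C x)" and "C \<ge> 0"
    and C: "\<And>x. norm x \<le> C * norm (T x - \<mu> *\<^sub>C x)" and near: "C * cmod (\<nu> - \<mu>) \<le> 1/2"
  shows "op_invertible (\<lambda>x. T x - \<nu> *\<^sub>C x)" "norm x \<le> 2 * C * norm (T x - \<nu> *\<^sub>C x)"
proof -
  have eq: "T x - \<mu> *\<^sub>C x - (\<nu> - \<mu>) *\<^sub>C x = T x - \<nu> *\<^sub>C x" for x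
    by (simp add: complex_vector.scale_left_diff_distrib)
  have "C * norm ((\<nu> - \<mu>) *\<^sub>C x) \<le> norm x / 2" for x :: 'a
    using mult_right_mono[OF near norm_ge_zero[of x]] by (simp add: mult_ac)
  from op_invertible_perturb[OF bounded_clinear_shift[OF T] inv \<open>C \<ge> 0\<close> C
      bounded_clinear_scaleC_id this, unfolded eq]
  show "op_invertible (\<lambda>x. T x - \<nu> *\<^sub>C x)" "norm x \<le> 2 * C * norm (T x - \<nu> *\<^sub>C x)" .
qed

lemma closed_op_spectrum:
  fixes T :: "'a::chilbert_space \<Rightarrow> 'a"
  assumes T: "bounded_clinear T"
  shows "closed (op_spectrum T)"
proof -
  have "\<exists>e>0. ball \<mu> e \<subseteq> - op_spectrum T" if mu: "\<mu> \<in> - op_spectrum T" for \<mu>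
  proof -
    have inv: "op_invertible (\<lambda>x. T x - \<mu> *\<^sub>C x)" using mu by (simp add: op_spectrum_def)
    obtain C where C: "C > 0" "\<And>x. norm x \<le> C * norm (T x - \<mu> *\<^sub>C x)"
      using op_invertibleE[OF inv] by metis
    have "\<nu> \<notin> op_spectrum T" if "\<nu> \<in> ball \<mu> (1 / (2 * C))" for \<nu>
    proof -
      have "C * cmod (\<nu> - \<mu>) \<le> 1/2"
        using that C(1) by (simp add: dist_norm norm_minus_commute field_simps)
      from resolvent_nearby(1)[OF T inv _ C(2) this] C(1) show ?thesis
        by (simp add: op_spectrum_def)
    qed
    then show ?thesis using C(1) by (intro exI[of _ "1 / (2 * C)"]) auto
  qed
  then show ?thesis by (simp add: closed_def open_contains_ball)
qed

lemma op_invertible_scaleC: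
  assumes "a \<noteq> 0"
  shows "op_invertible (\<lambda>x. a *\<^sub>C x)"
  unfolding op_invertible_def using assms
  by (intro exI[of _ "\<lambda>x. inverse a *\<^sub>C x"])
    (auto simp: bounded_clinear_scaleC_id scaleC_scaleC scaleC_one fun_eq_iff)

lemma op_invertible_uminus:
  assumes "bounded_clinear A" "op_invertible A"
  shows "op_invertible (\<lambda>x. - A x)"
proof -
  obtain S where S: "bounded_clinear S" "\<And>x. S (A x) = x" "\<And>x. A (S x) = x"
    using op_invertibleE[OF assms(2)] by metis
  have "bounded_clinear (\<lambda>x. S (-1 *\<^sub>C x))"
    by (rule bounded_clinear_compose[OF S(1) bounded_clinear_scaleC_id])
  moreover have "S (- A x) = - x" "A (S (- x)) = - x" for x
    using bounded_clinear_scale[OF S(1), of "-1"] S(2) S(3)[of "- x"] by simp_all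
  ultimately show ?thesis
    unfolding op_invertible_def
    by (intro exI[of _ "\<lambda>x. S (-1 *\<^sub>C x)"]) (auto simp: fun_eq_iff S)
qed

text \<open>Far out, \<open>T\<close> is a small perturbation of \<open>z\<close> times the
  identity, whence the change of sign at the end. The decay \<open>2 / cmod z\<close> feeds
  Liouville's theorem.\<close>

lemma resolvent_at_infinity:
  fixes T :: "'a::chilbert_space \<Rightarrow> 'a"
  assumes T: "bounded_clinear T"
  obtains K where "K > 0" "\<And>z. cmod z \<ge> K \<Longrightarrow> op_invertible (\<lambda>x. T x - z *\<^sub>C x)"
    "\<And>z x. cmod z \<ge> K \<Longrightarrow> norm x \<le> 2 / cmod z * norm (T x - z *\<^sub>C x)"
proof -
  obtain K where K: "\<And>x. norm (T x) \<le> norm x * K" "K > 0"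
    using bounded_linear.pos_bounded[OF bounded_clinear_imp_bounded_linear[OF T]] by blast
  have "op_invertible (\<lambda>x. T x - z *\<^sub>C x) \<and> (\<forall>x. norm x \<le> 2 / cmod z * norm (T x - z *\<^sub>C x))"
    if z: "cmod z \<ge> 2 * K" for z
  proof -
    have z0: "z \<noteq> 0" using z K(2) by auto
    have "cmod (1 / z) * norm (T x) \<le> norm x / 2" for x
    proof -
      have "norm (T x) * 2 \<le> norm x * cmod z"
        using K(1)[of x] mult_left_mono[OF z norm_ge_zero[of x]] by simp
      then show ?thesis using z0 by (simp add: norm_divide field_simps)
    qed
    moreover have "norm x \<le> cmod (1 / z) * norm (z *\<^sub>C x)" for x :: 'a
      using z0 by (simp add: norm_divide)
    ultimately have *: "op_invertible (\<lambda>x. z *\<^sub>C x - T x)"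
        "norm x \<le> 2 * cmod (1 / z) * norm (z *\<^sub>C x - T x)" for x
      using op_invertible_perturb[OF bounded_clinear_scaleC_id op_invertible_scaleC[OF z0]
          norm_ge_zero _ T, of "1 / z"] by blast+
    have "op_invertible (\<lambda>x. - (z *\<^sub>C x - T x))"
      by (intro op_invertible_uminus bounded_clinear_diff bounded_clinear_scaleC_id T *)
    then show ?thesis using *(2) by (simp add: norm_divide norm_minus_commute)
  qed
  then show ?thesis using K(2) by (intro that[of "2 * K"]) auto
qed

lemma compact_op_spectrum:
  fixes T :: "'a::chilbert_space \<Rightarrow> 'a"
  assumes T: "bounded_clinear T"
  shows "compact (op_spectrum T)"
proof -
  obtain K where K: "\<And>z. cmod z \<ge> K \<Longrightarrow> op_invertible (\<lambda>x. T x - z *\<^sub>C x)"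
    using resolvent_at_infinity[OF T] by metis
  then have "bounded (op_spectrum T)"
    by (intro boundedI[of _ K]) (auto simp: op_spectrum_def intro: less_imp_le leI)
  then show ?thesis using closed_op_spectrum[OF T] by (simp add: compact_eq_bounded_closed)
qed

lemma op_spectrum_adjoint:
  fixes T :: "'a::chilbert_space \<Rightarrow> 'a"
  assumes TS: "is_adjoint T S"
  shows "op_spectrum S = cnj ` op_spectrum T"
proof -
  have *: "op_invertible (\<lambda>x. T x - z *\<^sub>C x) \<longleftrightarrow> op_invertible (\<lambda>x. S x - cnj z *\<^sub>C x)" for z
    using op_invertible_adjoint is_adjoint_shift[OF TS] is_adjoint_sym by blast
  show ?thesis
    unfolding op_spectrum_def using * by (auto simp: image_iff) (metis complex_cnj_cnj)
qed

lemma frontier_cnj_image: "frontier (cnj ` A) = cnj ` frontier A"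
proof -
  have "linear cnj" by (rule bounded_linear.linear[OF bounded_linear_cnj])
  moreover have "inj cnj" by (auto intro: injI)
  ultimately show ?thesis
    by (simp add: frontier_def closure_injective_linear_image interior_injective_linear_image
        image_set_diff)
qed

subsection \<open>Invariant half-spaces\<close>

definition has_half_space :: "('a::complex_inner \<Rightarrow> 'a) \<Rightarrow> bool"
  where "has_half_space T \<longleftrightarrow> (\<exists>M. csubspace M \<and> closed M \<and> op_invariant T M \<and>
    \<not> cfinite_dim M \<and> \<not> cfinite_codim M)"

lemma cfinite_dim_subset: "cfinite_dim B \<Longrightarrow> A \<subseteq> B \<Longrightarrow> cfinite_dim A"
  unfolding cfinite_dim_def by blast

lemma infinite_dim_independent:
  "complex_vector.independent X \<Longrightarrow> infinite X \<Longrightarrow> \<not> cfinite_dim X"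
  unfolding cfinite_dim_def using complex_vector.independent_span_bound by blast

text \<open>A vector \<open>v0\<close> of \<open>V\<close> off the hyperplane corrects every other
  vector of \<open>V\<close> into it, so one linear condition lowers the dimension by at most
  one.\<close>

lemma infinite_dim_orthogonal_one:
  assumes V: "csubspace V" "\<not> cfinite_dim V"
  shows "\<not> cfinite_dim (V \<inter> {v. cinner v b = 0})"
proof
  assume "cfinite_dim (V \<inter> {v. cinner v b = 0})"
  then obtain C where C: "finite C" "V \<inter> {v. cinner v b = 0} \<subseteq> cspan C"
    by (auto simp: cfinite_dim_def)
  then have "\<not> V \<subseteq> {v. cinner v b = 0}" using V(2) by (auto simp: cfinite_dim_def)
  then obtain v0 where v0: "v0 \<in> V" "cinner v0 b \<noteq> 0" by auto
  have "v \<in> cspan (insert v0 C)" if "v \<in> V" for v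
  proof -
    have "v - (cinner v b / cinner v0 b) *\<^sub>C v0 \<in> V \<inter> {v. cinner v b = 0}"
      using v0 that V(1)
      by (auto simp: cinner_simps intro!: complex_vector.subspace_diff complex_vector.subspace_scale)
    then show ?thesis using C(2) by (auto simp: complex_vector.span_breakdown_eq)
  qed
  then have "V \<subseteq> cspan (insert v0 C)" by blast
  then show False using V(2) C(1) unfolding cfinite_dim_def by blast
qed

lemma infinite_dim_ex_orthogonal:
  assumes V: "csubspace V" "\<not> cfinite_dim V" and "finite B"
  shows "\<exists>v\<in>V. v \<noteq> 0 \<and> (\<forall>b\<in>B. cinner v b = 0)"
proof -
  have "csubspace (V \<inter> {v. \<forall>b\<in>B. cinner v b = 0}) \<and>
    \<not> cfinite_dim (V \<inter> {v. \<forall>b\<in>B. cinner v b = 0})"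
    using \<open>finite B\<close>
  proof (induction B)
    case empty
    then show ?case using V by simp
  next
    case (insert b B)
    have eq: "V \<inter> {v. \<forall>b\<in>insert b B. cinner v b = 0} =
        (V \<inter> {v. \<forall>b\<in>B. cinner v b = 0}) \<inter> {v. cinner v b = 0}"
      by auto
    show ?case unfolding eq
      using insert.IH csubspace_orthogonal infinite_dim_orthogonal_one
      by (auto intro: complex_vector.subspace_inter)
  qed
  moreover have "cfinite_dim {0}" unfolding cfinite_dim_def by (rule exI[of _ "{}"]) simp
  ultimately have "\<not> V \<inter> {v. \<forall>b\<in>B. cinner v b = 0} \<subseteq> {0}" using cfinite_dim_subset by blast
  then show ?thesis by auto
qed

text \<open>The closed span of \<open>X\<close> is the half-space and \<open>Y\<close> witnesses its
  codimension: if finitely many vectors complemented it, some nonzero vector of the span of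
  \<open>Y\<close> would be orthogonal to them and to \<open>X\<close>, hence to itself.\<close>

lemma has_half_spaceI:
  assumes T: "bounded_clinear T" and eig: "\<And>x. x \<in> X \<Longrightarrow> \<exists>z. T x = z *\<^sub>C x"
    and orth: "\<And>x y. x \<in> X \<Longrightarrow> y \<in> Y \<Longrightarrow> cinner x y = 0"
    and X: "\<not> cfinite_dim X" and Y: "\<not> cfinite_dim Y"
  shows "has_half_space T"
proof -
  let ?M = "closure (cspan X)"
  have "csubspace {x. T x \<in> cspan X}"
    by (rule complex_vector.subspaceI)
      (auto simp: bounded_clinear_add_apply[OF T] bounded_clinear_scale[OF T]
        bounded_clinear_zero_apply[OF T] complex_vector.span_zero
        intro: complex_vector.span_add complex_vector.span_scale)
  moreover have "T x \<in> cspan X" if "x \<in> X" for x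
    using eig[OF that] that complex_vector.span_base complex_vector.span_scale by metis
  ultimately have "cspan X \<subseteq> {x. T x \<in> cspan X}"
    by (intro complex_vector.span_minimal) auto
  then have "T ` ?M \<subseteq> ?M"
    by (intro image_closure_subset bounded_linear.continuous_on[OF bounded_clinear_imp_bounded_linear[OF T]]
        continuous_intros) (use closure_subset in auto)
  then have "op_invariant T ?M" by (auto simp: op_invariant_def)
  moreover have "X \<subseteq> ?M" using complex_vector.span_superset closure_subset by blast
  then have "\<not> cfinite_dim ?M" using X cfinite_dim_subset by blast
  moreover have "\<not> cfinite_codim ?M"
  proof
    assume "cfinite_codim ?M"
    then obtain B where B: "finite B" "cspan (?M \<union> B) = UNIV" by (auto simp: cfinite_codim_def)
    have "\<not> cfinite_dim (cspan Y)"
      using Y cfinite_dim_subset complex_vector.span_superset by blast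
    then obtain v where v: "v \<in> cspan Y" "v \<noteq> 0" "\<And>b. b \<in> B \<Longrightarrow> cinner v b = 0"
      using infinite_dim_ex_orthogonal[OF complex_vector.subspace_span _ B(1)] by blast
    have "cinner v x = 0" if "x \<in> X" for x
      using orth[OF that] cinner_eq_0_commute by (blast intro: orthogonal_cspan[OF _ v(1)])
    then have "cspan X \<subseteq> {m. cinner m v = 0}"
      by (intro complex_vector.span_minimal csubspace_orthogonal) (auto simp: cinner_eq_0_commute)
    moreover have "closed {m. cinner m v = 0}"
      by (intro closed_Collect_eq continuous_on_cinner continuous_intros)
    ultimately have "?M \<subseteq> {m. cinner m v = 0}" by (rule closure_minimal)
    then have "\<And>u. u \<in> ?M \<union> B \<Longrightarrow> cinner u v = 0"
      using v(3) by (auto simp: cinner_eq_0_commute)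
    then have "cinner v v = 0" using orthogonal_cspan[of "?M \<union> B" v v] B(2) by auto
    then show False using v(2) by simp
  qed
  ultimately show ?thesis
    unfolding has_half_space_def
    by (intro exI[of _ ?M]) (simp add: closure_csubspace complex_vector.subspace_span)
qed

text \<open>Every subspace of an eigenspace is invariant, so an orthogonal sequence in it can be
  split into two infinite halves: one spans the half-space, the other testifies to its
  codimension.\<close>

lemma has_half_space_eigenspace:
  assumes T: "bounded_clinear T" and inf: "\<not> cfinite_dim {x. T x = z *\<^sub>C x}"
  shows "has_half_space T"
proof -
  let ?V = "{x. T x = z *\<^sub>C x}"
  have V: "csubspace ?V"
    by (rule complex_vector.subspaceI)
      (simp_all add: bounded_clinear_add_apply[OF T] bounded_clinear_scale[OF T]
        bounded_clinear_zero_apply[OF T] scaleC_add_right scaleC_scaleC mult.commute)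
  have "\<exists>f. \<forall>n::nat. f n \<in> ?V \<and> f n \<noteq> 0 \<and> (\<forall>i<n. cinner (f n) (f i) = 0)"
  proof (rule dependent_wellorder_choice)
    show "\<exists>r. r \<in> ?V \<and> r \<noteq> 0 \<and> (\<forall>i<n. cinner r (f i) = 0)" for n :: nat and f
      using infinite_dim_ex_orthogonal[OF V inf, of "f ` {..<n}"] by auto
  qed auto
  then obtain f where f: "\<And>n::nat. f n \<in> ?V" "\<And>n. f n \<noteq> 0"
      "\<And>n i. i < n \<Longrightarrow> cinner (f n) (f i) = 0"
    by blast
  have orth: "cinner (f i) (f j) = 0" if "i \<noteq> j" for i j
    using f(3) that by (metis cinner_eq_0_commute nat_neq_iff)
  have "inj f"
    using orth f(2) by (metis cinner_same_eq_0_iff injI)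
  have "complex_vector.independent (range f)"
    unfolding complex_vector.dependent_def
  proof
    assume "\<exists>a\<in>range f. a \<in> cspan (range f - {a})"
    then obtain i where "f i \<in> cspan (range f - {f i})" by auto
    then have "cinner (f i) (f i) = 0"
      by (rule orthogonal_cspan[rotated]) (auto intro!: orth)
    then show False using f(2) by simp
  qed
  then have dim: "\<not> cfinite_dim (f ` A)" if "infinite A" for A
    using that \<open>inj f\<close> complex_vector.independent_mono[of "range f" "f ` A"]
    by (intro infinite_dim_independent) (auto simp: finite_image_iff inj_on_subset)
  obtain A B :: "nat set" where AB: "infinite A" "infinite B" "A \<inter> B = {}"
    using infinite_split[OF infinite_UNIV_nat] by metis
  show ?thesis
  proof (rule has_half_spaceI[OF T, of "f ` A" "f ` B"])
    show "\<exists>z. T x = z *\<^sub>C x" if "x \<in> f ` A" for x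
      using that f(1) by auto
    show "cinner x y = 0" if "x \<in> f ` A" "y \<in> f ` B" for x y
      using that AB(3) by (auto intro!: orth)
  qed (use dim AB in auto)
qed

section \<open>Eigenvectors and joint eigenvalues\<close>

lemma independent_eigenvectors:
  assumes T: "bounded_clinear T" and eig: "\<And>v. v \<in> S \<Longrightarrow> v \<noteq> 0 \<and> T v = ev v *\<^sub>C v"
    and inj: "inj_on ev S"
  shows "complex_vector.independent S"
  unfolding complex_vector.independent_explicit_finite_subsets
proof (intro allI impI ballI)
  fix A u v
  assume A: "A \<subseteq> S" "finite A" and sum: "(\<Sum>v\<in>A. u v *\<^sub>C v) = 0" and v: "v \<in> A"
  have "\<forall>v\<in>A. u v = 0" using A(2,1) sum
  proof (induction A arbitrary: u)
    case empty
    then show ?case by simp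
  next
    case (insert a A)
    have "T 0 = T (\<Sum>v\<in>insert a A. u v *\<^sub>C v)" by (simp only: insert.prems(2))
    also have "\<dots> = (\<Sum>v\<in>insert a A. T (u v *\<^sub>C v))"
      by (rule linear_sum) (rule bounded_linear.linear[OF bounded_clinear_imp_bounded_linear[OF T]])
    also have "\<dots> = (\<Sum>v\<in>insert a A. (u v * ev v) *\<^sub>C v)"
    proof (rule sum.cong[OF refl])
      fix v assume "v \<in> insert a A"
      then have "T v = ev v *\<^sub>C v" using eig insert.prems(1) by blast
      then show "T (u v *\<^sub>C v) = (u v * ev v) *\<^sub>C v"
        by (simp only: bounded_clinear_scale[OF T] scaleC_scaleC)
    qed
    finally have 1: "(\<Sum>v\<in>insert a A. (u v * ev v) *\<^sub>C v) = 0"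
      unfolding bounded_clinear_zero_apply[OF T] by (rule sym)
    have 2: "(\<Sum>v\<in>insert a A. (u v * ev a) *\<^sub>C v) = 0"
      using arg_cong[OF insert.prems(2), of "\<lambda>x. ev a *\<^sub>C x"]
      by (simp only: complex_vector.scale_sum_right scaleC_scaleC mult.commute[of "ev a"]
          complex_vector.scale_zero_right)
    \<comment> \<open>Subtracting \<open>ev a\<close> times the relation from its image under
      \<open>T\<close> cancels the term of \<open>a\<close> and multiplies the other coefficients by
      nonzero differences of eigenvalues.\<close>
    have "(\<Sum>v\<in>insert a A. (u v * (ev v - ev a)) *\<^sub>C v) = 0"
      unfolding right_diff_distrib complex_vector.scale_left_diff_distrib sum_subtractf 1 2 by simp
    then have "(\<Sum>v\<in>A. (u v * (ev v - ev a)) *\<^sub>C v) = 0"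
      using insert.hyps by simp
    with insert.prems(1) have "\<forall>v\<in>A. u v * (ev v - ev a) = 0"
      by (intro insert.IH) auto
    moreover have "ev v \<noteq> ev a" if "v \<in> A" for v
      using that insert.hyps(2) insert.prems(1) inj_onD[OF inj, of v a] by blast
    ultimately have A0: "\<forall>v\<in>A. u v = 0" by auto
    then have "u a *\<^sub>C a = 0" using insert.prems(2) insert.hyps by simp
    moreover have "a \<noteq> 0" using eig insert.prems(1) by blast
    ultimately show ?case using A0 by simp
  qed
  then show "u v = 0" using v by blast
qed

lemma infinite_dim_eigenvectors:
  assumes T: "bounded_clinear T" and "infinite Z" and eig: "\<And>z. z \<in> Z \<Longrightarrow> op_eigenvalue T z"
  obtains x where "\<And>z. z \<in> Z \<Longrightarrow> T (x z) = z *\<^sub>C x z" "\<not> cfinite_dim (x ` Z)"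
proof -
  obtain x where x: "\<And>z. z \<in> Z \<Longrightarrow> x z \<noteq> 0 \<and> T (x z) = z *\<^sub>C x z"
    using eig unfolding op_eigenvalue_def by metis
  have "inj_on x Z"
  proof (rule inj_onI)
    fix z w assume "z \<in> Z" "w \<in> Z" "x z = x w"
    then have "z *\<^sub>C x z = w *\<^sub>C x z" using x by metis
    then show "z = w" using x \<open>z \<in> Z\<close> by simp
  qed
  have "complex_vector.independent (x ` Z)"
    by (rule independent_eigenvectors[OF T, where ev = "the_inv_into Z x"])
      (use x \<open>inj_on x Z\<close> in \<open>auto simp: the_inv_into_f_f inj_on_the_inv_into\<close>)
  then have "\<not> cfinite_dim (x ` Z)"
    using \<open>infinite Z\<close> \<open>inj_on x Z\<close> by (intro infinite_dim_independent) (auto dest: finite_imageD)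
  then show ?thesis using that x by blast
qed

text \<open>Intended for \<open>S\<close> the adjoint of \<open>T\<close>. Keeping \<open>S\<close>
  as an argument lets the two operators trade places, with eigenvalues conjugated.\<close>

definition joint_eigenvalues :: "('a::complex_inner \<Rightarrow> 'a) \<Rightarrow> ('a \<Rightarrow> 'a) \<Rightarrow> complex set"
  where "joint_eigenvalues T S = {z. op_eigenvalue T z \<and> op_eigenvalue S (cnj z)}"

lemma infinite_joint_eigenvalues_sym:
  assumes "infinite (joint_eigenvalues S T)"
  shows "infinite (joint_eigenvalues T S)"
proof -
  have "joint_eigenvalues S T \<subseteq> cnj ` joint_eigenvalues T S"
    unfolding joint_eigenvalues_def by (auto simp: image_iff) (metis complex_cnj_cnj)
  then show ?thesis using assms finite_surj by blast
qed

lemma has_half_space_joint_eigenvalues: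
  assumes TS: "is_adjoint T S" and inf: "infinite (joint_eigenvalues T S)"
  shows "has_half_space T"
proof -
  note T = is_adjointD(1)[OF TS] and S = is_adjointD(2)[OF TS]
  obtain A B where AB: "A \<subseteq> joint_eigenvalues T S" "B \<subseteq> joint_eigenvalues T S"
    "infinite A" "infinite B" "A \<inter> B = {}"
    using infinite_split[OF inf] by metis
  obtain x where x: "\<And>z. z \<in> A \<Longrightarrow> T (x z) = z *\<^sub>C x z" "\<not> cfinite_dim (x ` A)"
    using infinite_dim_eigenvectors[OF T AB(3)] AB(1) unfolding joint_eigenvalues_def by blast
  have "infinite (cnj ` B)" using AB(4) by (auto dest: finite_imageD simp: inj_on_def)
  then obtain y where y: "\<And>z. z \<in> cnj ` B \<Longrightarrow> S (y z) = z *\<^sub>C y z" "\<not> cfinite_dim (y ` cnj ` B)"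
    using infinite_dim_eigenvectors[OF S, of "cnj ` B"] AB(2) unfolding joint_eigenvalues_def by blast
  show ?thesis
  proof (rule has_half_spaceI[OF T])
    show "cinner u v = 0" if uv: "u \<in> x ` A" "v \<in> y ` cnj ` B" for u v
    proof -
      obtain a b where ab: "a \<in> A" "u = x a" "b \<in> B" "v = y (cnj b)" using uv by blast
      have "a * cinner u v = b * cinner u v"
        using is_adjointD(3)[OF TS, of u v] x(1)[OF ab(1)] y(1)[of "cnj b"] ab
        by (simp add: cinner_simps)
      moreover have "a \<noteq> b" using ab AB(5) by auto
      ultimately show ?thesis by simp
    qed
  qed (use x y in auto)
qed

subsection \<open>The resolvent and its poles\<close>

text \<open>Sign convention: the inverse of \<open>T - \<mu>\<close>, not of
  \<open>\<mu> - T\<close>. Because of \<open>inv\<close> the function is total; its values are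
  meaningful outside the spectrum.\<close>

definition resolvent :: "('a::complex_inner \<Rightarrow> 'a) \<Rightarrow> complex \<Rightarrow> 'a \<Rightarrow> 'a"
  where "resolvent T \<mu> = inv (\<lambda>x. T x - \<mu> *\<^sub>C x)"

lemma resolvent:
  assumes "\<mu> \<notin> op_spectrum T"
  shows resolvent_left: "resolvent T \<mu> (T x - \<mu> *\<^sub>C x) = x"
    and resolvent_right: "T (resolvent T \<mu> x) - \<mu> *\<^sub>C resolvent T \<mu> x = x"
    and bounded_clinear_resolvent: "bounded_clinear (resolvent T \<mu>)"
proof -
  have inv: "op_invertible (\<lambda>x. T x - \<mu> *\<^sub>C x)" using assms by (simp add: op_spectrum_def)
  obtain S where S: "bounded_clinear S" "\<And>x. S (T x - \<mu> *\<^sub>C x) = x"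
      "\<And>x. T (S x) - \<mu> *\<^sub>C S x = x"
    using op_invertibleE[OF inv] by metis
  have "inv (\<lambda>x. T x - \<mu> *\<^sub>C x) = S"
    by (rule inv_unique_comp) (auto simp: fun_eq_iff S(2,3))
  then have R: "resolvent T \<mu> = S" by (simp add: resolvent_def)
  show "resolvent T \<mu> (T x - \<mu> *\<^sub>C x) = x" "T (resolvent T \<mu> x) - \<mu> *\<^sub>C resolvent T \<mu> x = x"
    "bounded_clinear (resolvent T \<mu>)"
    unfolding R using S by blast+
qed

text \<open>The resolvent cancels the first summand of
  \<open>(T - \<mu>) + (\<mu> - \<alpha>)\<close>. For \<alpha> = \<zeta> the factor
  \<open>\<mu> - \<zeta>\<close> lowers the order of a pole; for another point \<alpha> outside the
  spectrum the resolvent identity results.\<close>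

lemma resolvent_shift:
  assumes T: "bounded_clinear T" and \<mu>: "\<mu> \<notin> op_spectrum T"
  shows "resolvent T \<mu> (T z - \<alpha> *\<^sub>C z) = z + (\<mu> - \<alpha>) *\<^sub>C resolvent T \<mu> z"
proof -
  note R = bounded_clinear_resolvent[OF \<mu>]
  have "T z - \<alpha> *\<^sub>C z = (T z - \<mu> *\<^sub>C z) + (\<mu> - \<alpha>) *\<^sub>C z"
    by (simp add: complex_vector.scale_left_diff_distrib)
  then show ?thesis
    by (simp only: bounded_clinear_add_apply[OF R] bounded_clinear_scale[OF R] resolvent_left[OF \<mu>])
qed

lemma resolvent_identity:
  assumes T: "bounded_clinear T" and \<mu>: "\<mu> \<notin> op_spectrum T" and \<nu>: "\<nu> \<notin> op_spectrum T"
  shows "resolvent T \<nu> x - resolvent T \<mu> x = (\<nu> - \<mu>) *\<^sub>C resolvent T \<nu> (resolvent T \<mu> x)"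
  using resolvent_shift[OF T \<nu>, of "resolvent T \<mu> x" \<mu>]
  by (simp add: resolvent_right[OF \<mu>])

lemma eventually_not_spectrum:
  fixes T :: "'a::chilbert_space \<Rightarrow> 'a"
  assumes T: "bounded_clinear T" and \<mu>: "\<mu> \<notin> op_spectrum T"
  shows "\<forall>\<^sub>F \<nu> in at \<mu>. \<nu> \<notin> op_spectrum T"
proof -
  have "open (- op_spectrum T)" using closed_op_spectrum[OF T] by blast
  from eventually_at_in_open'[OF this, of \<mu>] \<mu> show ?thesis by simp
qed

lemma tendsto_resolvent:
  fixes T :: "'a::chilbert_space \<Rightarrow> 'a"
  assumes T: "bounded_clinear T" and \<mu>: "\<mu> \<notin> op_spectrum T"
  shows "((\<lambda>\<nu>. resolvent T \<nu> z) \<longlongrightarrow> resolvent T \<mu> z) (at \<mu>)"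
proof -
  let ?w = "resolvent T \<mu> z"
  have inv: "op_invertible (\<lambda>x. T x - \<mu> *\<^sub>C x)" using \<mu> by (simp add: op_spectrum_def)
  obtain C where C: "C > 0" "\<And>x. norm x \<le> C * norm (T x - \<mu> *\<^sub>C x)"
    using op_invertibleE[OF inv] by metis
  have "\<forall>\<^sub>F \<nu> in at \<mu>. norm (resolvent T \<nu> z - ?w) \<le> cmod (\<nu> - \<mu>) * (2 * C * norm ?w)"
  proof -
    have "\<forall>\<^sub>F \<nu> in at \<mu>. dist \<nu> \<mu> < 1 / (2 * C)"
      by (rule eventually_at_in_open'[of "ball \<mu> (1 / (2 * C))", THEN eventually_mono])
        (use C(1) in \<open>auto simp: dist_commute\<close>)
    then show ?thesis using eventually_not_spectrum[OF T \<mu>]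
    proof eventually_elim
      case (elim \<nu>)
      have "C * cmod (\<nu> - \<mu>) \<le> 1/2" using elim(1) C(1) by (simp add: dist_norm field_simps)
      from resolvent_nearby(2)[OF T inv less_imp_le[OF C(1)] C(2) this, of "resolvent T \<nu> ?w"]
      have "norm (resolvent T \<nu> ?w) \<le> 2 * C * norm ?w"
        by (simp add: resolvent_right[OF elim(2)])
      then show ?case
        unfolding resolvent_identity[OF T \<mu> elim(2)] norm_scaleC by (intro mult_left_mono) auto
    qed
  qed
  moreover have "((\<lambda>\<nu>. cmod (\<nu> - \<mu>) * (2 * C * norm ?w)) \<longlongrightarrow> 0) (at \<mu>)"
    by (rule tendsto_mult_left_zero[OF tendsto_norm_zero[OF LIM_zero[OF tendsto_ident_at]]])
  ultimately have "((\<lambda>\<nu>. resolvent T \<nu> z - ?w) \<longlongrightarrow> 0) (at \<mu>)"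
    by (rule Lim_null_comparison)
  then show ?thesis by (simp add: LIM_zero_iff)
qed

text \<open>By the resolvent identity the difference quotient at \<mu> is
  \<open>cinner (resolvent T \<nu> (resolvent T \<mu> x)) y\<close>, so continuity in \<nu> yields
  the derivative. Scalar coefficients suffice, and classical function theory applies to
  them.\<close>

lemma holomorphic_resolvent:
  fixes T :: "'a::chilbert_space \<Rightarrow> 'a"
  assumes T: "bounded_clinear T"
  shows "(\<lambda>\<mu>. cinner (resolvent T \<mu> x) y) holomorphic_on - op_spectrum T"
proof -
  have "((\<lambda>\<mu>. cinner (resolvent T \<mu> x) y) has_field_derivative
      cinner (resolvent T \<mu> (resolvent T \<mu> x)) y) (at \<mu>)" if \<mu>: "\<mu> \<notin> op_spectrum T" for \<mu>
  proof -
    have ev: "\<forall>\<^sub>F \<nu> in at \<mu>. cinner (resolvent T \<nu> (resolvent T \<mu> x)) y =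
        (cinner (resolvent T \<nu> x) y - cinner (resolvent T \<mu> x) y) / (\<nu> - \<mu>)"
      using eventually_not_spectrum[OF T \<mu>] eventually_neq_at_within[of \<mu> \<mu> UNIV]
    proof eventually_elim
      case (elim \<nu>)
      then show ?case
        unfolding cinner_diff_left[symmetric] resolvent_identity[OF T \<mu> elim(1)]
        by (simp add: cinner_scaleC_left)
    qed
    have "((\<lambda>\<nu>. cinner (resolvent T \<nu> (resolvent T \<mu> x)) y) \<longlongrightarrow>
        cinner (resolvent T \<mu> (resolvent T \<mu> x)) y) (at \<mu>)"
      by (intro tendsto_cinner tendsto_resolvent T \<mu> tendsto_const)
    then show ?thesis
      unfolding has_field_derivative_iff by (rule Lim_transform_eventually) (rule ev)
  qed
  then show ?thesis
    unfolding holomorphic_on_def field_differentiable_def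
    by (blast intro: has_field_derivative_at_within)
qed

text \<open>Encoded as polynomial growth in a punctured neighbourhood free of spectrum. Regular
  points are included and \<open>p\<close> only bounds the order. The negation covers essential
  singularities as well as accumulation points of the spectrum, which a perturbation might
  create.\<close>

definition pole_at :: "('a::complex_inner \<Rightarrow> 'a) \<Rightarrow> complex \<Rightarrow> bool"
  where "pole_at T \<zeta> \<longleftrightarrow> (\<exists>p C. \<forall>\<^sub>F \<mu> in at \<zeta>. \<mu> \<notin> op_spectrum T \<and>
    (\<forall>x. cmod (\<mu> - \<zeta>) ^ p * norm (resolvent T \<mu> x) \<le> C * norm x))"

text \<open>A removable singularity for the single vector \<open>z\<close>. If a fixed
  \<open>z\<close> has this property at every spectral point, Liouville's theorem applies to its
  resolvent coefficients.\<close>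

definition resolvent_bounded_near :: "('a::complex_inner \<Rightarrow> 'a) \<Rightarrow> complex \<Rightarrow> 'a \<Rightarrow> bool"
  where "resolvent_bounded_near T \<zeta> z \<longleftrightarrow>
    (\<exists>B. \<forall>\<^sub>F \<mu> in at \<zeta>. \<mu> \<notin> op_spectrum T \<and> norm (resolvent T \<mu> z) \<le> B)"

lemma eventually_at_cmod_le: "e > 0 \<Longrightarrow> \<forall>\<^sub>F \<mu> in at \<zeta>. cmod (\<mu> - \<zeta>) \<le> e"
  unfolding eventually_at by (auto simp: dist_norm intro: exI[of _ e])

text \<open>Factors that clear the singularity at another point \<alpha> do no harm at \<zeta>,
  since \<open>\<mu> - \<alpha>\<close> stays bounded near \<zeta>.\<close>

lemma resolvent_bounded_near_shift:
  assumes T: "bounded_clinear T" and z: "resolvent_bounded_near T \<zeta> z"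
  shows "resolvent_bounded_near T \<zeta> (T z - \<alpha> *\<^sub>C z)"
proof -
  obtain B where B: "\<forall>\<^sub>F \<mu> in at \<zeta>. \<mu> \<notin> op_spectrum T \<and> norm (resolvent T \<mu> z) \<le> B"
    using z by (auto simp: resolvent_bounded_near_def)
  have "\<forall>\<^sub>F \<mu> in at \<zeta>. \<mu> \<notin> op_spectrum T \<and>
      norm (resolvent T \<mu> (T z - \<alpha> *\<^sub>C z)) \<le> norm z + (1 + cmod (\<zeta> - \<alpha>)) * B"
    using B eventually_at_cmod_le[OF zero_less_one, of \<zeta>]
  proof eventually_elim
    case (elim \<mu>)
    have "norm (resolvent T \<mu> (T z - \<alpha> *\<^sub>C z)) \<le> norm z + cmod (\<mu> - \<alpha>) * norm (resolvent T \<mu> z)"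
      using elim norm_triangle_ineq[of z "(\<mu> - \<alpha>) *\<^sub>C resolvent T \<mu> z"]
      by (simp add: resolvent_shift[OF T])
    moreover have "cmod (\<mu> - \<alpha>) \<le> 1 + cmod (\<zeta> - \<alpha>)"
      using elim norm_triangle_ineq[of "\<mu> - \<zeta>" "\<zeta> - \<alpha>"] by simp
    then have "cmod (\<mu> - \<alpha>) * norm (resolvent T \<mu> z) \<le> (1 + cmod (\<zeta> - \<alpha>)) * B"
      using elim by (intro mult_mono) auto
    ultimately show ?case using elim by simp
  qed
  then show ?thesis unfolding resolvent_bounded_near_def by blast
qed

lemma resolvent_bounded_near_funpow_shift:
  assumes T: "bounded_clinear T" and z: "resolvent_bounded_near T \<zeta> z"
  shows "resolvent_bounded_near T \<zeta> (((\<lambda>x. T x - \<alpha> *\<^sub>C x) ^^ p) z)"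
  by (induction p) (simp_all add: z resolvent_bounded_near_shift[OF T])

text \<open>Each factor \<open>T - \<zeta>\<close> lowers the order by one, because the resolvent
  sends its value at \<open>z\<close> to \<open>z\<close> plus \<open>\<mu> - \<zeta>\<close> times
  the old resolvent vector. Since \<open>z\<close> changes in every step, the induction ranges over
  all \<open>z\<close>.\<close>

lemma resolvent_bounded_near_pole:
  assumes T: "bounded_clinear T"
    and "\<exists>B. \<forall>\<^sub>F \<mu> in at \<zeta>. \<mu> \<notin> op_spectrum T \<and> cmod (\<mu> - \<zeta>) ^ p * norm (resolvent T \<mu> z) \<le> B"
  shows "resolvent_bounded_near T \<zeta> (((\<lambda>x. T x - \<zeta> *\<^sub>C x) ^^ p) z)"
  using assms(2)
proof (induction p arbitrary: z)
  case 0
  then show ?case by (simp add: resolvent_bounded_near_def)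
next
  case (Suc p)
  then obtain B where B: "\<forall>\<^sub>F \<mu> in at \<zeta>. \<mu> \<notin> op_spectrum T \<and>
      cmod (\<mu> - \<zeta>) ^ Suc p * norm (resolvent T \<mu> z) \<le> B"
    by blast
  have "\<forall>\<^sub>F \<mu> in at \<zeta>. \<mu> \<notin> op_spectrum T \<and>
      cmod (\<mu> - \<zeta>) ^ p * norm (resolvent T \<mu> (T z - \<zeta> *\<^sub>C z)) \<le> norm z + B"
    using B eventually_at_cmod_le[OF zero_less_one, of \<zeta>]
  proof eventually_elim
    case (elim \<mu>)
    have "norm (resolvent T \<mu> (T z - \<zeta> *\<^sub>C z)) \<le> norm z + cmod (\<mu> - \<zeta>) * norm (resolvent T \<mu> z)"
      using elim norm_triangle_ineq[of z "(\<mu> - \<zeta>) *\<^sub>C resolvent T \<mu> z"]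
      by (simp add: resolvent_shift[OF T])
    then have "cmod (\<mu> - \<zeta>) ^ p * norm (resolvent T \<mu> (T z - \<zeta> *\<^sub>C z)) \<le>
        cmod (\<mu> - \<zeta>) ^ p * norm z + cmod (\<mu> - \<zeta>) ^ Suc p * norm (resolvent T \<mu> z)"
      by (subst power_Suc2) (metis distrib_left mult.assoc mult_left_mono norm_ge_zero zero_le_power)
    moreover have "cmod (\<mu> - \<zeta>) ^ p * norm z \<le> norm z"
      using elim power_le_one[of "cmod (\<mu> - \<zeta>)" p] mult_right_mono[of _ 1 "norm z"] by fastforce
    ultimately show ?case using elim by auto
  qed
  then have "resolvent_bounded_near T \<zeta> (((\<lambda>x. T x - \<zeta> *\<^sub>C x) ^^ p) (T z - \<zeta> *\<^sub>C z))"
    by (intro Suc.IH) blast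
  then show ?case by (simp only: funpow_Suc_right o_apply)
qed

lemma pole_at_resolvent_bounded_near:
  assumes T: "bounded_clinear T" and "pole_at T \<zeta>"
  obtains p where "\<And>z. resolvent_bounded_near T \<zeta> (((\<lambda>x. T x - \<zeta> *\<^sub>C x) ^^ p) z)"
proof -
  obtain p C where *: "\<forall>\<^sub>F \<mu> in at \<zeta>. \<mu> \<notin> op_spectrum T \<and>
      (\<forall>x. cmod (\<mu> - \<zeta>) ^ p * norm (resolvent T \<mu> x) \<le> C * norm x)"
    using assms(2) by (auto simp: pole_at_def)
  have "resolvent_bounded_near T \<zeta> (((\<lambda>x. T x - \<zeta> *\<^sub>C x) ^^ p) z)" for z
    by (rule resolvent_bounded_near_pole[OF T], rule exI[of _ "C * norm z"])
      (rule eventually_mono[OF *], blast)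
  then show ?thesis by (rule that)
qed

section \<open>Removable singularities and Liouville's theorem\<close>

lemma removable_singularities:
  assumes "finite K" "open S" "K \<subseteq> S" "f holomorphic_on (S - K)"
    and "\<And>k. k \<in> K \<Longrightarrow> \<exists>B. \<forall>\<^sub>F z in at k. cmod (f z) \<le> B"
  shows "\<exists>g. g holomorphic_on S \<and> (\<forall>z\<in>S - K. g z = f z)"
  using assms
proof (induction K arbitrary: f)
  case empty
  then show ?case by (intro exI[of _ f]) simp
next
  case (insert k K)
  have op: "open (S - K)" by (rule open_Diff[OF insert.prems(1) finite_imp_closed[OF insert.hyps(1)]])
  have "f holomorphic_on (S - K - {k})"
    by (subst Diff_insert[symmetric]) (rule insert.prems(3))
  moreover have "k \<in> interior (S - K)"
    unfolding interior_open[OF op] using insert.prems(2) insert.hyps(2) by blast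
  moreover have "\<exists>B. \<forall>\<^sub>F z in at k. cmod (f z) \<le> B" using insert.prems(4) by blast
  ultimately have "\<exists>g. g holomorphic_on (S - K) \<and> (\<forall>z\<in>S - K - {k}. g z = f z)"
    by (rule holomorphic_on_extend_bounded[THEN iffD2])
  then obtain g where g: "g holomorphic_on (S - K)" "\<And>z. z \<in> S - K - {k} \<Longrightarrow> g z = f z"
    by blast
  have "\<exists>h. h holomorphic_on S \<and> (\<forall>z\<in>S - K. h z = g z)"
  proof (rule insert.IH)
    fix k' assume k': "k' \<in> K"
    then obtain B where B: "\<forall>\<^sub>F z in at k'. cmod (f z) \<le> B" using insert.prems(4) by blast
    \<comment> \<open>The bound at \<open>k'\<close> is known for \<open>f\<close> and wanted for
      \<open>g\<close>; the two agree on a punctured neighbourhood of \<open>k'\<close> that avoids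
      the other exceptional points.\<close>
    have "open (S - insert k K - {k'} \<union> {k'})"
    proof -
      have "S - insert k K - {k'} \<union> {k'} = S - (insert k K - {k'})" using insert.prems(2) k' by blast
      then show ?thesis using open_Diff[OF insert.prems(1), of "insert k K - {k'}"] insert.hyps(1)
        by (metis finite_Diff finite_imp_closed finite_insert)
    qed
    then have "\<forall>\<^sub>F z in at k'. z \<in> S - insert k K - {k'} \<union> {k'} - {k'}"
      using eventually_at_in_open by blast
    with B have "\<forall>\<^sub>F z in at k'. cmod (g z) \<le> B"
      by eventually_elim (use g(2) in auto)
    then show "\<exists>B. \<forall>\<^sub>F z in at k'. cmod (g z) \<le> B" by blast
  qed (use insert.prems(1,2) g(1) in auto)
  then obtain h where h: "h holomorphic_on S" "\<And>z. z \<in> S - K \<Longrightarrow> h z = g z" by blast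
  have "\<forall>z\<in>S - insert k K. h z = f z"
  proof
    fix z assume "z \<in> S - insert k K"
    then have "z \<in> S - K" "z \<in> S - K - {k}" by auto
    then show "h z = f z" using g(2) h(2) by simp
  qed
  then show ?case using h(1) by blast
qed

text \<open>Each coefficient \<open>cinner (resolvent T \<mu> z) y\<close> extends to an entire
  function that vanishes at infinity, hence is zero; then \<open>z\<close> is zero because the
  resolvent is injective.\<close>

lemma eq_0_if_resolvent_bounded_near:
  fixes T :: "'a::chilbert_space \<Rightarrow> 'a"
  assumes T: "bounded_clinear T" and fin: "finite (op_spectrum T)"
    and z: "\<And>\<zeta>. \<zeta> \<in> op_spectrum T \<Longrightarrow> resolvent_bounded_near T \<zeta> z"
  shows "z = 0"
proof -
  obtain K where K: "K > 0" "\<And>\<mu>. cmod \<mu> \<ge> K \<Longrightarrow> op_invertible (\<lambda>x. T x - \<mu> *\<^sub>C x)"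
      "\<And>\<mu> x. cmod \<mu> \<ge> K \<Longrightarrow> norm x \<le> 2 / cmod \<mu> * norm (T x - \<mu> *\<^sub>C x)"
    using resolvent_at_infinity[OF T] by metis
  have Kout: "\<mu> \<notin> op_spectrum T" if "cmod \<mu> \<ge> K" for \<mu>
    using K(2)[OF that] by (simp add: op_spectrum_def)
  have "cinner (resolvent T \<mu> z) y = 0" if \<mu>: "\<mu> \<notin> op_spectrum T" for \<mu> y
  proof -
    let ?f = "\<lambda>\<mu>. cinner (resolvent T \<mu> z) y"
    have "\<exists>g. g holomorphic_on UNIV \<and> (\<forall>\<mu>\<in>UNIV - op_spectrum T. g \<mu> = ?f \<mu>)"
    proof (rule removable_singularities[OF fin open_UNIV])
      show "?f holomorphic_on UNIV - op_spectrum T"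
        using holomorphic_resolvent[OF T] by (simp add: Compl_eq_Diff_UNIV)
      fix \<zeta> assume "\<zeta> \<in> op_spectrum T"
      then obtain B where "\<forall>\<^sub>F \<mu> in at \<zeta>. \<mu> \<notin> op_spectrum T \<and> norm (resolvent T \<mu> z) \<le> B"
        using z by (auto simp: resolvent_bounded_near_def)
      then have "\<forall>\<^sub>F \<mu> in at \<zeta>. cmod (?f \<mu>) \<le> B * norm y"
        by eventually_elim (meson mult_right_mono norm_cinner_le norm_ge_zero order_trans)
      then show "\<exists>B. \<forall>\<^sub>F \<mu> in at \<zeta>. cmod (?f \<mu>) \<le> B" by blast
    qed simp
    then obtain g where g: "g holomorphic_on UNIV" "\<And>\<mu>. \<mu> \<notin> op_spectrum T \<Longrightarrow> g \<mu> = ?f \<mu>"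
      by auto
    have "(g \<longlongrightarrow> 0) at_infinity"
    proof (rule Lim_null_comparison)
      show "\<forall>\<^sub>F \<mu> in at_infinity. norm (g \<mu>) \<le> 2 / cmod \<mu> * norm z * norm y"
      proof (rule eventually_at_infinityI[of K])
        fix \<mu> assume *: "K \<le> cmod \<mu>"
        have "cmod (g \<mu>) \<le> norm (resolvent T \<mu> z) * norm y"
          using g(2)[OF Kout[OF *]] norm_cinner_le by metis
        also have "\<dots> \<le> 2 / cmod \<mu> * norm z * norm y"
          using K(3)[OF *, of "resolvent T \<mu> z"]
          by (intro mult_right_mono) (simp_all add: resolvent_right[OF Kout[OF *]])
        finally show "norm (g \<mu>) \<le> 2 / cmod \<mu> * norm z * norm y" .
      qed
      have "((\<lambda>\<mu>. 2 / \<mu>) \<longlongrightarrow> 0) (at_infinity :: complex filter)"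
        by (intro tendsto_divide_0[OF tendsto_const] filterlim_ident)
      then have "((\<lambda>\<mu>. cmod (2 / \<mu>) * norm z * norm y) \<longlongrightarrow> 0) at_infinity"
        by (intro tendsto_mult_left_zero tendsto_norm_zero)
      then show "((\<lambda>\<mu>. 2 / cmod \<mu> * norm z * norm y) \<longlongrightarrow> 0) at_infinity"
        by (simp add: norm_divide)
    qed
    then have "g \<mu> = 0" by (rule Liouville_weak_0[OF g(1)])
    then show ?thesis using g(2)[OF \<mu>] by simp
  qed
  moreover have out: "of_real K \<notin> op_spectrum T" using K(1) by (intro Kout) simp
  ultimately have "cinner (resolvent T (of_real K) z) (resolvent T (of_real K) z) = 0" by blast
  then have "resolvent T (of_real K) z = 0" by simp
  then show "z = 0"
    using resolvent_right[OF out, of z]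
    by (simp add: bounded_clinear_zero_apply[OF T])
qed

text \<open>The preimage is an extension of \<open>W \<inter> range A\<close> by the kernel of
  \<open>A\<close>: lifts of a basis \<open>D\<close> of the former and a finite spanning set of the
  latter generate it. The subspace property is carried along for iteration.\<close>

lemma finite_dim_vimage:
  assumes A: "bounded_clinear A" and ker: "cfinite_dim {x. A x = 0}"
    and W: "csubspace W" "cfinite_dim W"
  shows "csubspace (A -` W) \<and> cfinite_dim (A -` W)"
proof
  show "csubspace (A -` W)"
    by (rule complex_vector.subspaceI)
      (simp_all add: bounded_clinear_add_apply[OF A] bounded_clinear_scale[OF A]
        bounded_clinear_zero_apply[OF A] complex_vector.subspace_0[OF W(1)]
        complex_vector.subspace_add[OF W(1)] complex_vector.subspace_scale[OF W(1)])
  obtain D where D: "D \<subseteq> W \<inter> range A" "complex_vector.independent D" "W \<inter> range A \<subseteq> cspan D"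
    using complex_vector.maximal_independent_subset[of "W \<inter> range A"] by metis
  have "finite D"
    using infinite_dim_independent[OF D(2)] W(2) D(1) cfinite_dim_subset by blast
  obtain f where f: "\<And>d. d \<in> D \<Longrightarrow> A (f d) = d" using D(1) by (metis IntE f_inv_into_f subsetD)
  obtain K where K: "finite K" "{x. A x = 0} \<subseteq> cspan K" using ker by (auto simp: cfinite_dim_def)
  have "csubspace (A ` cspan (f ` D))"
  proof (rule complex_vector.subspaceI)
    show "0 \<in> A ` cspan (f ` D)"
      using bounded_clinear_zero_apply[OF A] complex_vector.span_zero by (metis image_eqI)
    show "x + y \<in> A ` cspan (f ` D)" if "x \<in> A ` cspan (f ` D)" "y \<in> A ` cspan (f ` D)" for x y
      using that by (auto simp flip: bounded_clinear_add_apply[OF A] intro: complex_vector.span_add)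
    show "c *\<^sub>C x \<in> A ` cspan (f ` D)" if "x \<in> A ` cspan (f ` D)" for x c
      using that by (auto simp flip: bounded_clinear_scale[OF A] intro: complex_vector.span_scale)
  qed
  moreover have "D \<subseteq> A ` cspan (f ` D)"
    using f complex_vector.span_base by (metis image_eqI subsetI)
  ultimately have sub: "cspan D \<subseteq> A ` cspan (f ` D)" by (intro complex_vector.span_minimal)
  have "x \<in> cspan (f ` D \<union> K)" if Ax: "A x \<in> W" for x
  proof -
    obtain y where y: "y \<in> cspan (f ` D)" "A x = A y" using sub D(3) Ax by blast
    then have "x - y \<in> cspan K" using K(2) by (auto simp: bounded_clinear_diff_apply[OF A])
    then have "x - y \<in> cspan (f ` D \<union> K)" "y \<in> cspan (f ` D \<union> K)"
      using y(1) complex_vector.span_mono[of _ "f ` D \<union> K"] by blast+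
    then show ?thesis using complex_vector.span_add[of "x - y" _ y] by simp
  qed
  then show "cfinite_dim (A -` W)"
    unfolding cfinite_dim_def using \<open>finite D\<close> K(1) by (intro exI[of _ "f ` D \<union> K"]) auto
qed

lemma finite_dim_vimage_funpow:
  fixes A :: "'a::complex_inner \<Rightarrow> 'a"
  assumes A: "bounded_clinear A" and ker: "cfinite_dim {x. A x = 0}"
    and W: "csubspace W" "cfinite_dim W"
  shows "csubspace ((A ^^ p) -` W) \<and> cfinite_dim ((A ^^ p) -` W)"
proof (induction p)
  case 0
  have "(A ^^ 0) -` W = W" by auto
  then show ?case using W by metis
next
  case (Suc p)
  have "(A ^^ Suc p) -` W = A -` ((A ^^ p) -` W)" by (auto simp: funpow_swap1)
  then show ?case using finite_dim_vimage[OF A ker] Suc by metis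
qed

text \<open>If all singularities of the resolvent are poles, then Liouville's theorem shows that \<open>T\<close> is
  algebraic.\<close>

lemma ex_infinite_dim_eigenspace:
  fixes T :: "'a::chilbert_space \<Rightarrow> 'a"
  assumes inf: "\<not> cfinite_dim (UNIV :: 'a set)" and T: "bounded_clinear T"
    and fin: "finite (op_spectrum T)" and poles: "\<And>\<zeta>. \<zeta> \<in> op_spectrum T \<Longrightarrow> pole_at T \<zeta>"
  shows "\<exists>\<zeta>. \<not> cfinite_dim {x. T x = \<zeta> *\<^sub>C x}"
proof (rule ccontr)
  assume "\<not> ?thesis"
  then have ker: "cfinite_dim {x. T x - \<zeta> *\<^sub>C x = 0}" for \<zeta> by simp
  \<comment> \<open>\<open>P\<close> is a product of powers of \<open>T - \<zeta>\<close> over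
    \<zeta> in \<open>Z\<close>, known only by two properties: it clears the singularities at
    \<open>Z\<close>, and preimages of finite-dimensional subspaces remain finite-dimensional
    because the kernels of all \<open>T - \<zeta>\<close> are.\<close>
  have "\<exists>P :: 'a \<Rightarrow> 'a. (\<forall>x. \<forall>\<zeta>\<in>Z. resolvent_bounded_near T \<zeta> (P x)) \<and>
      (\<forall>W. csubspace W \<and> cfinite_dim W \<longrightarrow> csubspace (P -` W) \<and> cfinite_dim (P -` W))"
    if "Z \<subseteq> op_spectrum T" for Z
    using finite_subset[OF that fin] that
  proof (induction Z)
    case empty
    then show ?case by (intro exI[of _ "\<lambda>x. x"]) simp
  next
    case (insert \<zeta> Z)
    then obtain P :: "'a \<Rightarrow> 'a" where P: "\<And>x \<alpha>. \<alpha> \<in> Z \<Longrightarrow> resolvent_bounded_near T \<alpha> (P x)"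
        "\<And>W. csubspace W \<Longrightarrow> cfinite_dim W \<Longrightarrow> csubspace (P -` W) \<and> cfinite_dim (P -` W)"
      by (metis insert_subset)
    obtain p where p: "\<And>z. resolvent_bounded_near T \<zeta> (((\<lambda>x. T x - \<zeta> *\<^sub>C x) ^^ p) z)"
      using pole_at_resolvent_bounded_near[OF T poles] insert.prems by blast
    let ?Q = "\<lambda>x. ((\<lambda>x. T x - \<zeta> *\<^sub>C x) ^^ p) (P x)"
    have "resolvent_bounded_near T \<alpha> (?Q x)" if "\<alpha> \<in> insert \<zeta> Z" for x \<alpha>
      using that p P(1) resolvent_bounded_near_funpow_shift[OF T] by auto
    moreover have "csubspace (?Q -` W) \<and> cfinite_dim (?Q -` W)"
      if "csubspace W" "cfinite_dim W" for W
    proof -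
      have "?Q -` W = P -` (((\<lambda>x. T x - \<zeta> *\<^sub>C x) ^^ p) -` W)" by auto
      then show ?thesis
        using finite_dim_vimage_funpow[OF bounded_clinear_shift[OF T] ker that] P(2) by simp
    qed
    ultimately show ?case by (intro exI[of _ ?Q]) blast
  qed
  then obtain P :: "'a \<Rightarrow> 'a"
    where P: "\<And>x \<zeta>. \<zeta> \<in> op_spectrum T \<Longrightarrow> resolvent_bounded_near T \<zeta> (P x)"
      "\<And>W. csubspace W \<and> cfinite_dim W \<Longrightarrow> csubspace (P -` W) \<and> cfinite_dim (P -` W)"
    by (metis order_refl)
  \<comment> \<open>All singularities are now cleared at once, so the whole space is the preimage of
    \<open>{0}\<close> under \<open>P\<close>, against its infinite dimension.\<close>
  have "P x = 0" for x by (rule eq_0_if_resolvent_bounded_near[OF T fin P(1)])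
  then have "P -` {0} = UNIV" by auto
  moreover have "csubspace {0::'a} \<and> cfinite_dim {0::'a}"
    unfolding cfinite_dim_def by (auto intro!: exI[of _ "{}"])
  ultimately show False using P(2)[of "{0}"] inf by simp
qed

subsection \<open>Rank-one perturbations\<close>

text \<open>Sherman--Morrison formula: the resolvent changes by a rank-one term with the scalar
  denominator \<open>1 - cinner (resolvent T \<mu> g) k\<close>.\<close>

lemma rank_one_perturbation:
  assumes T: "bounded_clinear T" and \<mu>: "\<mu> \<notin> op_spectrum T"
    and ne: "cinner (resolvent T \<mu> g) k \<noteq> 1"
  shows not_in_spectrum_rank_one: "\<mu> \<notin> op_spectrum (\<lambda>x. T x - rank_one g k x)"
    and resolvent_rank_one: "resolvent (\<lambda>x. T x - rank_one g k x) \<mu> y = resolvent T \<mu> y +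
      (cinner (resolvent T \<mu> y) k / (1 - cinner (resolvent T \<mu> g) k)) *\<^sub>C resolvent T \<mu> g"
proof -
  let ?R = "resolvent T \<mu>"
  let ?\<phi> = "1 - cinner (?R g) k"
  let ?T' = "\<lambda>x. T x - rank_one g k x - \<mu> *\<^sub>C x"
  let ?S = "\<lambda>y. ?R y + (cinner (?R y) k / ?\<phi>) *\<^sub>C ?R g"
  note R = bounded_clinear_resolvent[OF \<mu>]
  have S: "bounded_clinear ?S"
  proof -
    have "?S = (\<lambda>y. ?R y + rank_one ((1 / ?\<phi>) *\<^sub>C ?R g) k (?R y))"
      by (simp add: rank_one_def scaleC_scaleC)
    then show ?thesis
      by (simp only: bounded_clinear_add bounded_clinear_compose bounded_clinear_rank_one R)
  qed
  have right: "?T' (?S y) = y" for y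
  proof -
    let ?c = "cinner (?R y) k / ?\<phi>"
    have "?T' (?S y) = (T (?R y) - \<mu> *\<^sub>C ?R y) + ?c *\<^sub>C (T (?R g) - \<mu> *\<^sub>C ?R g)
        - cinner (?R y + ?c *\<^sub>C ?R g) k *\<^sub>C g"
      by (simp add: rank_one_def bounded_clinear_add_apply[OF T] bounded_clinear_scale[OF T]
          scaleC_add_right complex_vector.scale_right_diff_distrib scaleC_scaleC mult.commute)
    also have "\<dots> = y + (?c - cinner (?R y + ?c *\<^sub>C ?R g) k) *\<^sub>C g"
      by (simp add: resolvent_right[OF \<mu>] complex_vector.scale_left_diff_distrib)
    also have "?c - cinner (?R y + ?c *\<^sub>C ?R g) k = 0"
      using ne by (simp add: cinner_simps field_simps)
    finally show ?thesis by simp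
  qed
  have left: "?S (?T' x) = x" for x
  proof -
    have "?T' x = (T x - \<mu> *\<^sub>C x) - cinner x k *\<^sub>C g" by (simp add: rank_one_def)
    then have "?R (?T' x) = ?R (T x - \<mu> *\<^sub>C x) - ?R (cinner x k *\<^sub>C g)"
      by (simp only: bounded_clinear_diff_apply[OF R, of "T x - \<mu> *\<^sub>C x"])
    then have Rx: "?R (?T' x) = x - cinner x k *\<^sub>C ?R g"
      by (simp only: resolvent_left[OF \<mu>] bounded_clinear_scale[OF R])
    have "cinner (?R (?T' x)) k / ?\<phi> = cinner x k"
      unfolding Rx using ne by (simp add: cinner_simps field_simps)
    then show ?thesis unfolding Rx by simp
  qed
  have "?S \<circ> ?T' = id" "?T' \<circ> ?S = id" using left right by (simp_all add: fun_eq_iff)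
  then show *: "\<mu> \<notin> op_spectrum (\<lambda>x. T x - rank_one g k x)"
    using S unfolding op_spectrum_def op_invertible_def by blast
  show "resolvent (\<lambda>x. T x - rank_one g k x) \<mu> y = ?S y"
    using resolvent_left[OF *, of "?S y"] unfolding right .
qed

text \<open>A zero denominator makes \<open>resolvent T \<mu> g\<close> an eigenvector of the
  perturbed operator for \<mu>. The same effect later creates eigenvalues on purpose.\<close>

lemma rank_one_perturbation_singular:
  assumes T: "bounded_clinear T" and \<mu>: "\<mu> \<notin> op_spectrum T"
    and \<mu>': "\<mu> \<notin> op_spectrum (\<lambda>x. T x - rank_one g k x)"
  shows "cinner (resolvent T \<mu> g) k \<noteq> 1"
proof
  assume *: "cinner (resolvent T \<mu> g) k = 1"
  let ?x = "resolvent T \<mu> g"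
  have "T ?x - rank_one g k ?x - \<mu> *\<^sub>C ?x = 0"
    using resolvent_right[OF \<mu>, of g] * by (simp add: rank_one_def scaleC_one algebra_simps)
  then have "?x = 0"
    using resolvent_left[OF \<mu>', of ?x] bounded_clinear_zero_apply[OF bounded_clinear_resolvent[OF \<mu>']]
    by simp
  then show False using * by simp
qed

text \<open>On a connected domain a holomorphic function that is not identically zero has only zeros
  of finite order, so near \<zeta> it is bounded below by a power; exponent 0 serves if \<zeta> is
  no zero.\<close>

lemma holomorphic_lower_bound_near:
  assumes h: "h holomorphic_on ball \<zeta> r" and w: "w \<in> ball \<zeta> r" "h w \<noteq> 0" and "r > 0"
  shows "\<exists>c>0. \<exists>n. \<forall>\<^sub>F z in at \<zeta>. c * cmod (z - \<zeta>) ^ n \<le> cmod (h z)"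
proof (cases "h \<zeta> = 0")
  case True
  obtain c n s where cns: "0 < c" "0 < s" "\<And>z. z \<in> ball \<zeta> s \<Longrightarrow> c * cmod (z - \<zeta>) ^ n \<le> cmod (h z - h \<zeta>)"
    using holomorphic_lower_bound_difference[OF h open_ball connected_ball, of \<zeta> w] w True \<open>r > 0\<close>
    by (metis centre_in_ball)
  then have "\<forall>\<^sub>F z in at \<zeta>. c * cmod (z - \<zeta>) ^ n \<le> cmod (h z)"
    using True eventually_at_ball[OF \<open>0 < s\<close>, of \<zeta> UNIV] by (auto elim: eventually_mono)
  then show ?thesis using \<open>0 < c\<close> by blast
next
  case False
  have "isCont h \<zeta>"
    using holomorphic_on_imp_continuous_on[OF h] \<open>r > 0\<close> by (simp add: continuous_on_eq_continuous_at)
  then have "((\<lambda>z. cmod (h z)) \<longlongrightarrow> cmod (h \<zeta>)) (at \<zeta>)" by (intro tendsto_norm) (simp add: isCont_def)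
  then have "\<forall>\<^sub>F z in at \<zeta>. cmod (h \<zeta>) / 2 < cmod (h z)" using False by (intro order_tendstoD) auto
  then have "\<forall>\<^sub>F z in at \<zeta>. cmod (h \<zeta>) / 2 * cmod (z - \<zeta>) ^ 0 \<le> cmod (h z)"
    by (rule eventually_mono) simp
  moreover have "cmod (h \<zeta>) / 2 > 0" using False by simp
  ultimately show ?thesis by blast
qed

text \<open>By the Sherman--Morrison formula the resolvent of the perturbed operator is a rational
  expression in the old one, with a scalar holomorphic denominator that is not identically zero.\<close>

lemma pole_at_rank_one:
  fixes T :: "'a::chilbert_space \<Rightarrow> 'a"
  assumes T: "bounded_clinear T" and pole: "pole_at T \<zeta>"
    and freq: "\<exists>\<^sub>F \<mu> in at \<zeta>. \<mu> \<notin> op_spectrum (\<lambda>x. T x - rank_one g k x)"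
  shows "pole_at (\<lambda>x. T x - rank_one g k x) \<zeta>"
proof -
  let ?T' = "\<lambda>x. T x - rank_one g k x"
  obtain p C' where C': "\<forall>\<^sub>F \<mu> in at \<zeta>. \<mu> \<notin> op_spectrum T \<and>
      (\<forall>x. cmod (\<mu> - \<zeta>) ^ p * norm (resolvent T \<mu> x) \<le> C' * norm x)"
    using pole by (auto simp: pole_at_def)
  define C where "C = \<bar>C'\<bar>"
  have "C \<ge> 0" by (simp add: C_def)
  have C: "\<forall>\<^sub>F \<mu> in at \<zeta>. \<mu> \<notin> op_spectrum T \<and>
      (\<forall>x. cmod (\<mu> - \<zeta>) ^ p * norm (resolvent T \<mu> x) \<le> C * norm x)"
    using C' unfolding C_def
    by eventually_elim (meson abs_ge_self mult_right_mono norm_ge_zero order_trans)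
  then obtain r where r: "r > 0" "\<And>\<mu>. \<mu> \<noteq> \<zeta> \<Longrightarrow> dist \<mu> \<zeta> < r \<Longrightarrow> \<mu> \<notin> op_spectrum T"
    unfolding eventually_at by auto
  define \<phi> where "\<phi> \<mu> = 1 - cinner (resolvent T \<mu> g) k" for \<mu>
  \<comment> \<open>The factor clears the possible pole of the denominator \<phi>, so that
    \<open>f\<close> is bounded near \<zeta> and extends holomorphically.\<close>
  define f where "f \<mu> = (\<mu> - \<zeta>) ^ p * \<phi> \<mu>" for \<mu>
  have "f holomorphic_on ball \<zeta> r - {\<zeta>}"
    unfolding f_def \<phi>_def
    by (intro holomorphic_intros holomorphic_on_subset[OF holomorphic_resolvent[OF T]])
      (use r(2) in \<open>auto simp: dist_commute\<close>)
  moreover have "\<zeta> \<in> interior (ball \<zeta> r)" using r(1) by (simp add: interior_open)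
  moreover have "\<forall>\<^sub>F \<mu> in at \<zeta>. cmod (f \<mu>) \<le> 1 + C * norm g * norm k"
    using C eventually_at_cmod_le[OF zero_less_one, of \<zeta>]
  proof eventually_elim
    case (elim \<mu>)
    have "cmod (f \<mu>) \<le> cmod (\<mu> - \<zeta>) ^ p * (1 + norm (resolvent T \<mu> g) * norm k)"
      unfolding f_def \<phi>_def norm_mult norm_power
      by (intro mult_left_mono order_trans[OF norm_triangle_ineq4])
        (simp_all add: norm_cinner_le)
    also have "\<dots> = cmod (\<mu> - \<zeta>) ^ p + cmod (\<mu> - \<zeta>) ^ p * norm (resolvent T \<mu> g) * norm k"
      by (simp add: algebra_simps)
    also have "\<dots> \<le> 1 + C * norm g * norm k"
      using elim by (intro add_mono mult_right_mono power_le_one) auto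
    finally show ?case .
  qed
  ultimately obtain h where h: "h holomorphic_on ball \<zeta> r" "\<And>\<mu>. \<mu> \<in> ball \<zeta> r - {\<zeta>} \<Longrightarrow> h \<mu> = f \<mu>"
    using holomorphic_on_extend_bounded[of f "ball \<zeta> r" \<zeta>] by blast
  have "\<forall>\<^sub>F \<mu> in at \<zeta>. \<mu> \<in> ball \<zeta> r \<and> \<mu> \<noteq> \<zeta>"
    using eventually_at_ball'[OF r(1), of \<zeta> UNIV] by simp
  then have in_ball: "\<forall>\<^sub>F \<mu> in at \<zeta>. \<mu> \<in> ball \<zeta> r - {\<zeta>}" by simp
  have "\<exists>\<^sub>F \<mu> in at \<zeta>. \<mu> \<notin> op_spectrum ?T' \<and> \<mu> \<in> ball \<zeta> r - {\<zeta>}"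
    using frequently_eventually_frequently[OF freq in_ball] .
  \<comment> \<open>One point at which the perturbed operator is invertible shows that the extension
    of \<open>f\<close> is not identically zero; this is what \<open>freq\<close> is for.\<close>
  then obtain w where w: "w \<notin> op_spectrum ?T'" "w \<in> ball \<zeta> r - {\<zeta>}"
    using frequently_ex by blast
  have "w \<notin> op_spectrum T" using w(2) r(2) by (auto simp: dist_commute)
  then have "\<phi> w \<noteq> 0"
    using rank_one_perturbation_singular[OF T _ w(1)] by (simp add: \<phi>_def)
  then have "h w \<noteq> 0" using w(2) h(2)[OF w(2)] by (simp add: f_def)
  then obtain c n where c: "c > 0" "\<forall>\<^sub>F \<mu> in at \<zeta>. c * cmod (\<mu> - \<zeta>) ^ n \<le> cmod (h \<mu>)"
    using holomorphic_lower_bound_near[OF h(1) _ _ r(1), of w] w(2) by blast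
  \<comment> \<open>The exponent pays \<open>p\<close> for each of the two resolvents in the
    correction term and \<open>n\<close> for the denominator.\<close>
  have "\<forall>\<^sub>F \<mu> in at \<zeta>. \<mu> \<notin> op_spectrum ?T' \<and> (\<forall>x. cmod (\<mu> - \<zeta>) ^ (p + p + n) *
      norm (resolvent ?T' \<mu> x) \<le> (C + C * norm k * C * norm g / c) * norm x)"
    using C c(2) in_ball eventually_at_cmod_le[OF zero_less_one, of \<zeta>]
  proof eventually_elim
    case (elim \<mu>)
    define d where "d = cmod (\<mu> - \<zeta>)"
    let ?R = "resolvent T \<mu>"
    have d: "0 < d" "d \<le> 1" using elim by (simp_all add: d_def)
    have \<mu>: "\<mu> \<notin> op_spectrum T" and bd: "\<And>x. d ^ p * norm (?R x) \<le> C * norm x"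
      using elim by (simp_all add: d_def)
    have "c * d ^ n \<le> d ^ p * cmod (\<phi> \<mu>)"
      using elim h(2)[of \<mu>] by (simp add: d_def f_def norm_mult norm_power)
    also have "\<dots> \<le> 1 * cmod (\<phi> \<mu>)" using d by (intro mult_right_mono power_le_one) auto
    finally have low: "c * d ^ n \<le> cmod (\<phi> \<mu>)" by simp
    then have "cmod (\<phi> \<mu>) > 0" using c(1) d(1) by (smt (verit) mult_pos_pos zero_less_power)
    then have ne: "cinner (?R g) k \<noteq> 1" by (auto simp: \<phi>_def)
    have "d ^ (p + p + n) * norm (resolvent ?T' \<mu> x) \<le> (C + C * norm k * C * norm g / c) * norm x" for x
    proof -
      have "norm (resolvent ?T' \<mu> x) \<le> norm (?R x) + cmod (cinner (?R x) k) / cmod (\<phi> \<mu>) * norm (?R g)"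
        unfolding resolvent_rank_one[OF T \<mu> ne] \<phi>_def
        by (rule order_trans[OF norm_triangle_ineq]) (simp add: norm_divide)
      also have "\<dots> \<le> norm (?R x) + norm (?R x) * norm k / (c * d ^ n) * norm (?R g)"
        using low c(1) d(1)
        by (intro add_left_mono mult_right_mono frac_le norm_cinner_le) auto
      finally have "d ^ (p + p + n) * norm (resolvent ?T' \<mu> x) \<le> d ^ (p + p + n) *
          (norm (?R x) + norm (?R x) * norm k / (c * d ^ n) * norm (?R g))"
        using d by (intro mult_left_mono) auto
      also have "\<dots> = d ^ (p + n) * (d ^ p * norm (?R x)) +
          (d ^ p * norm (?R x)) * norm k * (d ^ p * norm (?R g)) / c"
        using c(1) d(1) by (simp add: power_add field_simps)
      also have "\<dots> \<le> 1 * (C * norm x) + (C * norm x) * norm k * (C * norm g) / c"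
      proof (rule add_mono)
        show "d ^ (p + n) * (d ^ p * norm (?R x)) \<le> 1 * (C * norm x)"
          by (rule mult_mono[OF _ bd]) (use d in \<open>simp_all add: power_le_one\<close>)
        have "(d ^ p * norm (?R x)) * norm k * (d ^ p * norm (?R g)) \<le> (C * norm x) * norm k * (C * norm g)"
          by (rule mult_mono[OF mult_right_mono[OF bd] bd]) (use d \<open>C \<ge> 0\<close> in simp_all)
        then show "(d ^ p * norm (?R x)) * norm k * (d ^ p * norm (?R g)) / c
            \<le> (C * norm x) * norm k * (C * norm g) / c"
          using c(1) by (intro divide_right_mono) auto
      qed
      also have "\<dots> = (C + C * norm k * C * norm g / c) * norm x"
        using c(1) by (simp add: field_simps)
      finally show ?thesis .
    qed
    then show ?case using not_in_spectrum_rank_one[OF T \<mu> ne] by (simp add: d_def)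
  qed
  then show ?thesis unfolding pole_at_def by blast
qed

text \<open>For each \<open>n\<close> the Sherman--Morrison denominator vanishes for at most one
  real \<open>t\<close>, so the bad values are countable and cannot fill the interval. Hence
  invertibility is protected along a sequence and not in a neighbourhood.\<close>

lemma ex_small_rank_one_avoiding_spectrum:
  assumes T: "bounded_clinear T" and \<mu>: "\<And>n::nat. \<mu> n \<notin> op_spectrum T" and "\<delta> > 0"
  shows "\<exists>t. 0 < t \<and> t < \<delta> \<and>
    (\<forall>n. \<mu> n \<notin> op_spectrum (\<lambda>x. T x - rank_one (complex_of_real t *\<^sub>C g) k x))"
proof -
  define bad where "bad = (\<Union>n. {t::real. complex_of_real t * cinner (resolvent T (\<mu> n) g) k = 1})"
  have sub: "{t::real. complex_of_real t * c = 1} \<subseteq> {Re (1 / c)}" for c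
  proof
    fix t assume "t \<in> {t::real. complex_of_real t * c = 1}"
    then have "complex_of_real t * c = 1" by simp
    moreover from this have "c \<noteq> 0" by auto
    ultimately have "complex_of_real t = 1 / c" by (simp add: eq_divide_eq)
    then have "t = Re (1 / c)" by (metis Re_complex_of_real)
    then show "t \<in> {Re (1 / c)}" by simp
  qed
  have "countable {t::real. complex_of_real t * c = 1}" for c
    by (rule countable_subset[OF sub]) simp
  then have "countable bad" unfolding bad_def by (intro countable_UN) auto
  then have "\<not> {0<..<\<delta>} \<subseteq> bad"
    using uncountable_open_interval[of 0 \<delta>] \<open>\<delta> > 0\<close> countable_subset[of "{0<..<\<delta>}" bad] by blast
  then obtain t where "t \<in> {0<..<\<delta>}" "t \<notin> bad" by blast
  then have t: "0 < t" "t < \<delta>" "t \<notin> bad" by simp_all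
  have "\<mu> n \<notin> op_spectrum (\<lambda>x. T x - rank_one (complex_of_real t *\<^sub>C g) k x)" for n
  proof (rule not_in_spectrum_rank_one[OF T \<mu>])
    show "cinner (resolvent T (\<mu> n) (complex_of_real t *\<^sub>C g)) k \<noteq> 1"
      using t(3) bounded_clinear_scale[OF bounded_clinear_resolvent[OF \<mu>]]
      by (auto simp: bad_def cinner_scaleC_left)
  qed
  then show ?thesis using t by blast
qed

section \<open>Lowering the dimension of a kernel\<close>

lemma bounded_clinear_cspan:
  assumes f: "bounded_clinear f" and "x \<in> cspan E"
  shows "f x \<in> cspan (f ` E)"
proof -
  have "csubspace {x. f x \<in> cspan (f ` E)}"
    by (rule complex_vector.subspaceI)
      (auto simp: bounded_clinear_add_apply[OF f] bounded_clinear_scale[OF f]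
        bounded_clinear_zero_apply[OF f] complex_vector.span_zero
        intro: complex_vector.span_add complex_vector.span_scale)
  then have "cspan E \<subseteq> {x. f x \<in> cspan (f ` E)}"
    by (rule complex_vector.span_minimal[rotated]) (auto intro: complex_vector.span_base)
  then show ?thesis using assms(2) by blast
qed

text \<open>Steinitz exchange puts \<open>k\<close> in place of some \<open>b\<close> of
  \<open>B\<close>. The orthogonal projection \<open>Q\<close> kills \<open>k\<close> and fixes the
  vectors orthogonal to it, so the images of the remaining generators suffice. Sizes of spanning
  sets stand in for dimensions.\<close>

lemma orthogonal_complement_in_smaller_span:
  assumes "finite B" and k: "k \<in> cspan B" "k \<noteq> 0"
  shows "\<exists>B'. finite B' \<and> card B' < card B \<and> cspan B \<inter> {x. cinner x k = 0} \<subseteq> cspan B'"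
proof -
  have "\<exists>b\<in>B. b \<in> cspan (insert k (B - {b}))" using \<open>finite B\<close> k(1)
  proof (induction B)
    case empty
    then show ?case using k(2) by simp
  next
    case (insert a B)
    show ?case
    proof (cases "k \<in> cspan B")
      case True
      then obtain b where b: "b \<in> B" "b \<in> cspan (insert k (B - {b}))" using insert.IH by blast
      moreover have "cspan (insert k (B - {b})) \<subseteq> cspan (insert k (insert a B - {b}))"
        by (intro complex_vector.span_mono) auto
      ultimately show ?thesis by blast
    next
      case False
      then have "a \<in> cspan (insert k B)"
        using complex_vector.in_span_insert insert.prems by blast
      then show ?thesis using insert.hyps(2) by simp
    qed
  qed
  then obtain b where b: "b \<in> B" "b \<in> cspan (insert k (B - {b}))" by blast
  define E where "E = B - {b}"
  have "B \<subseteq> cspan (insert k E)"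
    using b complex_vector.span_base[of _ "insert k E"] unfolding E_def by blast
  then have sub: "cspan B \<subseteq> cspan (insert k E)"
    by (intro complex_vector.span_minimal complex_vector.subspace_span)
  define Q where "Q x = x - rank_one ((1 / cinner k k) *\<^sub>C k) k x" for x
  have Q: "bounded_clinear Q"
    unfolding Q_def using bounded_clinear_diff[OF bounded_clinear_scaleC_id[of 1] bounded_clinear_rank_one]
    by (simp add: scaleC_one)
  have "cspan B \<inter> {x. cinner x k = 0} \<subseteq> cspan (Q ` E)"
  proof
    fix x assume x: "x \<in> cspan B \<inter> {x. cinner x k = 0}"
    then have "x \<in> cspan (insert k E)" using sub by blast
    then obtain c where c: "x - c *\<^sub>C k \<in> cspan E"
      by (auto simp: complex_vector.span_breakdown_eq)
    have "Q (x - c *\<^sub>C k) \<in> cspan (Q ` E)" by (rule bounded_clinear_cspan[OF Q c])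
    moreover have "Q (x - c *\<^sub>C k) = x"
      using x k(2) by (simp add: Q_def rank_one_def cinner_simps scaleC_scaleC)
    ultimately show "x \<in> cspan (Q ` E)" by simp
  qed
  moreover have "card (Q ` E) < card B"
    using card_image_le[of E Q] card_Diff1_less[of B b] \<open>finite B\<close> b(1) unfolding E_def by simp
  ultimately show ?thesis
    using \<open>finite B\<close> by (intro exI[of _ "Q ` E"]) (auto simp: E_def)
qed

text \<open>Subtracting a map from a vector of \<open>ker (T - \<zeta>)\<close> to a vector orthogonal to the range of
  \<open>T - \<zeta>\<close> lowers the dimension of the kernel.\<close>

lemma ex_perturbation_trivial_kernel:
  fixes T :: "'a::chilbert_space \<Rightarrow> 'a"
  assumes "is_adjoint T S" and \<mu>: "filterlim \<mu> (at \<zeta>) sequentially"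
    and "\<And>n::nat. \<mu> n \<notin> op_spectrum T" and "\<not> pole_at T \<zeta>"
    and "{x. T x = \<zeta> *\<^sub>C x} \<subseteq> cspan B" and "finite B" and "\<epsilon> > 0"
  shows "\<exists>F G. is_adjoint F G \<and> (\<forall>n. \<mu> n \<notin> op_spectrum (\<lambda>x. T x - F x)) \<and>
    \<not> pole_at (\<lambda>x. T x - F x) \<zeta> \<and> (\<exists>D. finite D \<and> card D \<le> card B \<and> range F \<subseteq> cspan D) \<and>
    (\<forall>x. norm (F x) \<le> \<epsilon> * norm x) \<and>
    ((\<forall>x. T x - F x = \<zeta> *\<^sub>C x \<longrightarrow> x = 0) \<or> (\<forall>x. S x - G x = cnj \<zeta> *\<^sub>C x \<longrightarrow> x = 0))"
  using assms(1,3-7)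
proof (induction "card B" arbitrary: B T S \<epsilon> rule: less_induct)
  case less
  note TS = less.prems(1) and spec = less.prems(2) and npole = less.prems(3)
    and B = less.prems(4,5) and \<epsilon> = less.prems(6)
  note T = is_adjointD(1)[OF TS]
  show ?case
  proof (cases "(\<forall>x. T x = \<zeta> *\<^sub>C x \<longrightarrow> x = 0) \<or> (\<forall>x. S x = cnj \<zeta> *\<^sub>C x \<longrightarrow> x = 0)")
    case True
    have "is_adjoint (\<lambda>x. 0) (\<lambda>x::'a. 0)" by (simp add: is_adjoint_def bounded_clinear_zero)
    moreover have "range (\<lambda>x::'a. 0::'a) \<subseteq> cspan {}" by simp
    ultimately show ?thesis
      using True spec npole \<epsilon>
      by (intro exI[of _ "\<lambda>x::'a. 0"] conjI exI[of _ "{}"]) auto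
  next
    case False
    then obtain k g where k: "T k = \<zeta> *\<^sub>C k" "k \<noteq> 0" and g: "S g = cnj \<zeta> *\<^sub>C g" "g \<noteq> 0" by blast
    \<comment> \<open>Scaling \<open>g\<close> by less than this keeps the norm of the rank-one
      operator below \<epsilon>/2; the other half is left to the induction hypothesis.\<close>
    define \<delta> where "\<delta> = \<epsilon> / 2 / (norm g * norm k)"
    have "\<delta> > 0" using \<epsilon> k g by (simp add: \<delta>_def)
    obtain t where t: "0 < t" "t < \<delta>"
        "\<And>n. \<mu> n \<notin> op_spectrum (\<lambda>x. T x - rank_one (complex_of_real t *\<^sub>C g) k x)"
      using ex_small_rank_one_avoiding_spectrum[where \<mu> = \<mu> and g = g and k = k, OF T spec \<open>\<delta> > 0\<close>] by blast
    define g' where "g' = complex_of_real t *\<^sub>C g"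
    define T1 where "T1 x = T x - rank_one g' k x" for x
    define S1 where "S1 x = S x - rank_one k g' x" for x
    have TS1: "is_adjoint T1 S1"
      unfolding T1_def S1_def by (rule is_adjoint_diff[OF TS is_adjoint_rank_one])
    note T1 = is_adjointD(1)[OF TS1]
    have spec1: "\<mu> n \<notin> op_spectrum T1" for n using t(3) unfolding T1_def g'_def by blast
    have npole1: "\<not> pole_at T1 \<zeta>"
    proof
      assume "pole_at T1 \<zeta>"
      \<comment> \<open>Undoing the perturbation is again a rank-one perturbation, so a pole of
        \<open>T1\<close> would give one of \<open>T\<close>; the sequence \<mu> supplies the
        required points outside the spectrum of \<open>T\<close>.\<close>
      have eq: "T1 x - rank_one (- g') k x = T x" for x by (simp add: T1_def rank_one_def)
      have "\<exists>\<^sub>F z in at \<zeta>. z \<notin> op_spectrum (\<lambda>x. T1 x - rank_one (- g') k x)"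
        unfolding eq frequently_def
      proof
        assume "\<forall>\<^sub>F z in at \<zeta>. \<not> z \<notin> op_spectrum T"
        then have "\<forall>\<^sub>F n in sequentially. \<not> \<mu> n \<notin> op_spectrum T"
          using \<mu> unfolding filterlim_iff by blast
        then show False using spec by (simp add: eventually_sequentially)
      qed
      from pole_at_rank_one[OF T1 \<open>pole_at T1 \<zeta>\<close> this] show False
        using npole unfolding eq by blast
    qed
    have ker1: "{x. T1 x = \<zeta> *\<^sub>C x} \<subseteq> cspan B \<inter> {x. cinner x k = 0}"
    proof
      fix x assume "x \<in> {x. T1 x = \<zeta> *\<^sub>C x}"
      then have x: "T x - \<zeta> *\<^sub>C x = (cinner x k * t) *\<^sub>C g"
        by (simp add: T1_def rank_one_def g'_def scaleC_scaleC algebra_simps)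
      \<comment> \<open>The range of \<open>T - \<zeta>\<close> is orthogonal to \<open>g\<close>,
        yet for \<open>x\<close> in the new kernel it contains a multiple of \<open>g\<close>.
        Pairing with \<open>g\<close> forces \<open>cinner x k = 0\<close>, so the new kernel
        consists of old kernel vectors orthogonal to \<open>k\<close>.\<close>
      have "cinner (T x - \<zeta> *\<^sub>C x) g = cinner x (S g - cnj \<zeta> *\<^sub>C g)"
        by (simp add: cinner_simps is_adjointD(3)[OF TS])
      then have "cinner x k = 0" unfolding x using g t(1) by (simp add: cinner_scaleC_left)
      then show "x \<in> cspan B \<inter> {x. cinner x k = 0}" using x B(1) by auto
    qed
    have "k \<in> cspan B" using k(1) B(1) by blast
    then obtain B1 where B1: "finite B1" "card B1 < card B" "cspan B \<inter> {x. cinner x k = 0} \<subseteq> cspan B1"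
      using orthogonal_complement_in_smaller_span[OF B(2) _ k(2)] by blast
    have "{x. T1 x = \<zeta> *\<^sub>C x} \<subseteq> cspan B1" using ker1 B1(3) by blast
    from less.hyps[OF B1(2) TS1 spec1 npole1 this B1(1) half_gt_zero[OF \<epsilon>]]
    obtain F G D where FG: "is_adjoint F G" "\<forall>n. \<mu> n \<notin> op_spectrum (\<lambda>x. T1 x - F x)"
        "\<not> pole_at (\<lambda>x. T1 x - F x) \<zeta>" "finite D" "card D \<le> card B1" "range F \<subseteq> cspan D"
        "\<forall>x. norm (F x) \<le> \<epsilon> / 2 * norm x"
        "(\<forall>x. T1 x - F x = \<zeta> *\<^sub>C x \<longrightarrow> x = 0) \<or> (\<forall>x. S1 x - G x = cnj \<zeta> *\<^sub>C x \<longrightarrow> x = 0)"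
      by (elim exE conjE) (rule that)
    let ?F = "\<lambda>x. rank_one g' k x + F x" and ?G = "\<lambda>x. rank_one k g' x + G x"
    have eqs: "T1 x - F x = T x - ?F x" "S1 x - G x = S x - ?G x" for x
      by (simp_all add: T1_def S1_def)
    have adj: "is_adjoint ?F ?G" by (rule is_adjoint_add[OF is_adjoint_rank_one FG(1)])
    have "range ?F \<subseteq> cspan (insert g' D)"
    proof
      fix y assume "y \<in> range ?F"
      then obtain x where "y = ?F x" by blast
      moreover have "F x \<in> cspan (insert g' D)"
        using FG(6) complex_vector.span_mono[of D "insert g' D"] by blast
      moreover have "rank_one g' k x \<in> cspan (insert g' D)"
        unfolding rank_one_def by (intro complex_vector.span_scale complex_vector.span_base) simp
      ultimately show "y \<in> cspan (insert g' D)" by (simp add: complex_vector.span_add)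
    qed
    moreover have "card (insert g' D) \<le> card B" "finite (insert g' D)"
      using FG(4,5) B1(2) card_insert_le_m1[of "card B" D g'] by auto
    moreover have "norm (?F x) \<le> \<epsilon> * norm x" for x
    proof -
      have "norm g' * norm k \<le> \<epsilon> / 2"
        using t(1,2) g(2) k(2) by (simp add: g'_def \<delta>_def field_simps)
      then have "norm (rank_one g' k x) \<le> \<epsilon> / 2 * norm x"
        by (meson norm_rank_one_le mult_right_mono norm_ge_zero order_trans)
      then show ?thesis using norm_triangle_ineq[of "rank_one g' k x" "F x"] FG(7)[rule_format, of x] by linarith
    qed
    ultimately show ?thesis
      using adj FG(2,3,8) unfolding eqs
      by (intro exI[of _ ?F] exI[of _ ?G] exI[of _ "insert g' D"] conjI allI) simp_all
  qed
qed

subsection \<open>A small functional taking the value one on a subsequence\<close>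

lemma cinner_sum_right: "cinner x (\<Sum>i\<in>A. f i) = (\<Sum>i\<in>A. cinner x (f i))"
  by (induction A rule: infinite_finite_induct) (simp_all add: cinner_add_right)

definition orthonormal :: "'a::complex_inner set \<Rightarrow> bool"
  where "orthonormal A \<longleftrightarrow> (\<forall>a\<in>A. norm a = 1) \<and> (\<forall>a\<in>A. \<forall>b\<in>A. a \<noteq> b \<longrightarrow> cinner a b = 0)"

lemma orthonormal_remainder:
  assumes "finite A" "orthonormal A" "a \<in> A"
  shows "cinner a (h - (\<Sum>b\<in>A. cinner h b *\<^sub>C b)) = 0"
proof -
  have "cinner a (\<Sum>b\<in>A. cinner h b *\<^sub>C b) = (\<Sum>b\<in>A. if b = a then cinner a h else 0)"
    unfolding cinner_sum_right
  proof (rule sum.cong[OF refl])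
    fix b assume b: "b \<in> A"
    show "cinner a (cinner h b *\<^sub>C b) = (if b = a then cinner a h else 0)"
    proof (cases "b = a")
      case True
      have "cinner a a = 1" using assms(2,3) by (simp add: cinner_same orthonormal_def)
      moreover have "cnj (cinner h a) = cinner a h" using cinner_commute[of a h] by simp
      ultimately show ?thesis using True by (simp add: cinner_scaleC_right)
    next
      case False
      then have "cinner a b = 0" using assms(2,3) b by (auto simp: orthonormal_def)
      then show ?thesis using False by (simp add: cinner_scaleC_right)
    qed
  qed
  also have "\<dots> = cinner a h" using assms(1,3) by simp
  finally show ?thesis by (simp add: cinner_diff_right)
qed

text \<open>One greedy step: \<open>h m\<close> is chosen long and nearly orthogonal to
  \<open>w\<close> and \<open>A\<close>. A small multiple of its component \<open>d\<close>
  orthogonal to \<open>A\<close> brings its pairing to one and leaves the values on the span of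
  \<open>A\<close> untouched. As \<open>h m\<close> lies outside that span, different steps yield
  different vectors.\<close>

lemma extend_orthonormal_functional:
  fixes h :: "nat \<Rightarrow> 'a::complex_inner"
  assumes unbdd: "\<And>N K. \<exists>n\<ge>N. K \<le> norm (h n)"
    and weak: "\<forall>z. \<forall>\<eta>>0. \<exists>N K. \<forall>n\<ge>N. K \<le> norm (h n) \<longrightarrow>
      cmod (cinner (h n) z) \<le> \<eta> * norm (h n)"
    and A: "finite A" "orthonormal A" and "\<delta> > 0"
  shows "\<exists>w' A'. finite A' \<and> orthonormal A' \<and> A \<subseteq> A' \<and> norm (w' - w) \<le> \<delta> \<and>
    (\<forall>a\<in>A. cinner a (w' - w) = 0) \<and>
    (\<exists>m. h m \<in> cspan A' \<and> h m \<notin> cspan A \<and> cinner (h m) w' = 1)"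
proof -
  \<comment> \<open>The bound \<open>\<delta> / 4\<close> keeps the correction small; the other one
    makes the projection of \<open>h m\<close> onto the span of \<open>A\<close> at most half as
    long as \<open>h m\<close>, with the summand 1 guarding against empty \<open>A\<close>.\<close>
  define \<eta> where "\<eta> = min (\<delta> / 4) (1 / (2 * (card A + 1)))"
  have \<eta>: "\<eta> > 0" using \<open>\<delta> > 0\<close> by (simp add: \<eta>_def)
  have "\<exists>N K. \<forall>n\<ge>N. K \<le> norm (h n) \<longrightarrow> (\<forall>z\<in>Z. cmod (cinner (h n) z) \<le> \<eta> * norm (h n))"
    if "finite Z" for Z
    using that
  proof (induction Z)
    case empty
    then show ?case by simp
  next
    case (insert z Z)
    obtain N1 K1 where 1: "\<forall>n\<ge>N1. K1 \<le> norm (h n) \<longrightarrow> (\<forall>z\<in>Z. cmod (cinner (h n) z) \<le> \<eta> * norm (h n))"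
      using insert.IH by blast
    obtain N2 K2 where 2: "\<forall>n\<ge>N2. K2 \<le> norm (h n) \<longrightarrow> cmod (cinner (h n) z) \<le> \<eta> * norm (h n)"
      using weak \<eta> by blast
    show ?case
      by (rule exI[of _ "max N1 N2"], rule exI[of _ "max K1 K2"]) (use 1 2 in simp)
  qed
  from this[of "insert w A"] obtain N K where
    NK: "\<And>n z. n \<ge> N \<Longrightarrow> K \<le> norm (h n) \<Longrightarrow> z \<in> insert w A \<Longrightarrow> cmod (cinner (h n) z) \<le> \<eta> * norm (h n)"
    using A(1) by (metis finite_insert)
  obtain m where m: "m \<ge> N" "max K (4 / \<delta>) \<le> norm (h m)" using unbdd by blast
  define H where "H = norm (h m)"
  have H: "H \<ge> 4 / \<delta>" "H > 0"
    using m(2) \<open>\<delta> > 0\<close> by (auto simp: H_def intro: less_le_trans[of 0 "4 / \<delta>"])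
  have small: "cmod (cinner (h m) z) \<le> \<eta> * H" if "z \<in> insert w A" for z
    unfolding H_def using m that by (intro NK) auto
  define p where "p = (\<Sum>b\<in>A. cinner (h m) b *\<^sub>C b)"
  define d where "d = h m - p"
  have p_span: "p \<in> cspan A"
    unfolding p_def by (intro complex_vector.span_sum complex_vector.span_scale complex_vector.span_base)
  have ad: "cinner a d = 0" if "a \<in> A" for a
    unfolding d_def p_def by (rule orthonormal_remainder[OF A that])
  have pd: "cinner v d = 0" if "v \<in> cspan A" for v
    using orthogonal_cspan[of A d v] ad that by blast
  have hd: "cinner (h m) d = complex_of_real ((norm d)\<^sup>2)"
  proof -
    have "cinner (h m) d = cinner (d + p) d" by (simp add: d_def)
    then show ?thesis using pd[OF p_span] by (simp add: cinner_add_left cinner_same)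
  qed
  have "norm p \<le> H / 2"
  proof -
    have "norm p \<le> (\<Sum>b\<in>A. norm (cinner (h m) b *\<^sub>C b))" unfolding p_def by (rule norm_sum)
    also have "\<dots> \<le> (\<Sum>b\<in>A. \<eta> * H)"
      using A(2) small by (intro sum_mono) (simp add: orthonormal_def)
    also have "\<dots> = H * (card A * \<eta>)" by simp
    also have "\<dots> \<le> H * (card A * (1 / (2 * (card A + 1))))"
      using H by (intro mult_left_mono) (auto simp: \<eta>_def)
    also have "\<dots> \<le> H * (1 / 2)" using H(2) by (intro mult_left_mono) (auto simp: field_simps)
    finally show ?thesis by simp
  qed
  then have dH: "norm d \<ge> H / 2"
    using norm_triangle_ineq2[of "h m" p] by (simp add: d_def H_def)
  then have d0: "norm d > 0" using H(2) by linarith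
  \<comment> \<open>Solves \<open>cinner (h m) (w + a d) = 1\<close>, given that
    \<open>cinner (h m) d\<close> is the square of \<open>norm d\<close>; the conjugate reflects
    antilinearity in the second argument.\<close>
  define a where "a = cnj ((1 - cinner (h m) w) / (norm d)\<^sup>2)"
  define w' where "w' = w + a *\<^sub>C d"
  define u where "u = complex_of_real (1 / norm d) *\<^sub>C d"
  have hw': "cinner (h m) w' = 1"
    using d0 by (simp add: w'_def cinner_simps hd a_def)
  have "norm (a *\<^sub>C d) = cmod (1 - cinner (h m) w) / norm d"
  proof -
    have "cmod a = cmod (1 - cinner (h m) w) / (norm d)\<^sup>2"
      unfolding a_def complex_mod_cnj by (simp add: norm_divide norm_power)
    then show ?thesis using d0 by (simp add: power2_eq_square)
  qed
  also have "\<dots> \<le> (1 + \<eta> * H) / (H / 2)"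
    using dH H(2) \<eta> small[of w] norm_triangle_ineq4[of 1 "cinner (h m) w"]
    by (intro frac_le) auto
  also have "\<dots> = 2 / H + 2 * \<eta>" using H(2) by (simp add: field_simps)
  also have "\<dots> \<le> \<delta> / 2 + 2 * (\<delta> / 4)"
  proof (rule add_mono)
    show "2 / H \<le> \<delta> / 2" using H \<open>\<delta> > 0\<close> by (simp add: field_simps)
    show "2 * \<eta> \<le> 2 * (\<delta> / 4)" by (simp add: \<eta>_def)
  qed
  finally have nw: "norm (w' - w) \<le> \<delta>" by (simp add: w'_def)
  have "norm u = 1" using d0 by (simp add: u_def norm_divide)
  moreover have "cinner b u = 0" "cinner u b = 0" if "b \<in> A" for b
    using ad[OF that] ad[OF that, unfolded cinner_eq_0_commute[of b]]
    by (simp_all add: u_def cinner_simps)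
  ultimately have ortho: "orthonormal (insert u A)"
    using A(2) by (auto simp: orthonormal_def)
  have "h m = norm d *\<^sub>C u + p" using d0 by (simp add: u_def scaleC_scaleC scaleC_one d_def)
  then have "h m \<in> cspan (insert u A)"
    using p_span complex_vector.span_mono[of A "insert u A"]
    by (simp add: complex_vector.span_add complex_vector.span_scale complex_vector.span_base subset_insertI subsetD)
  moreover have "h m \<notin> cspan A" using pd hd d0 by fastforce
  moreover have "\<forall>a\<in>A. cinner a (w' - w) = 0" using ad by (simp add: w'_def cinner_simps)
  ultimately show ?thesis
    using A(1) ortho nw hw' by (intro exI[of _ w'] exI[of _ "insert u A"]) blast
qed

text \<open>The functional is built greedily: each correction is orthogonal to the vectors treated so
  far and small, because the \<open>h n\<close>, once normalised, tend weakly to zero.\<close>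

lemma ex_small_functional:
  fixes h :: "nat \<Rightarrow> 'a::chilbert_space"
  assumes unbdd: "\<And>N K. \<exists>n\<ge>N. K \<le> norm (h n)"
    and weak: "\<forall>z. \<forall>\<eta>>0. \<exists>N K. \<forall>n\<ge>N. K \<le> norm (h n) \<longrightarrow>
      cmod (cinner (h n) z) \<le> \<eta> * norm (h n)"
    and "\<epsilon> > 0"
  shows "\<exists>w. norm w < \<epsilon> \<and> infinite (h ` {n. cinner (h n) w = 1})"
proof -
  \<comment> \<open>A state is the current vector with the orthonormal set treated so far. The
    clause for \<open>n = 0\<close> starts the vector at zero, so its limit is bounded by the sum of
    the corrections, which are allowed \<epsilon>/2 in total.\<close>
  define P where "P n s \<longleftrightarrow> finite (snd s) \<and> orthonormal (snd s) \<and> (n = 0 \<longrightarrow> fst s = 0)"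
    for n :: nat and s :: "'a \<times> 'a set"
  define Q where "Q n s s' \<longleftrightarrow> snd s \<subseteq> snd s' \<and> norm (fst s' - fst s) \<le> \<epsilon> / 4 * (1 / 2) ^ n \<and>
      (\<forall>a\<in>snd s. cinner a (fst s' - fst s) = 0) \<and>
      (\<exists>m. h m \<in> cspan (snd s') \<and> h m \<notin> cspan (snd s) \<and> cinner (h m) (fst s') = 1)"
    for n :: nat and s s' :: "'a \<times> 'a set"
  have "\<exists>f. \<forall>n. P n (f n) \<and> Q n (f n) (f (Suc n))"
  proof (rule dependent_nat_choice)
    show "\<exists>s. P 0 s" by (rule exI[of _ "(0, {})"]) (simp add: P_def orthonormal_def)
    fix s n assume "P n s"
    then have A: "finite (snd s)" "orthonormal (snd s)" by (simp_all add: P_def)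
    have pos: "\<epsilon> / 4 * (1 / 2) ^ n > 0" using \<open>\<epsilon> > 0\<close> by simp
    obtain w' A' m where "finite A'" "orthonormal A'" "snd s \<subseteq> A'"
      "norm (w' - fst s) \<le> \<epsilon> / 4 * (1 / 2) ^ n" "\<forall>a\<in>snd s. cinner a (w' - fst s) = 0"
      "h m \<in> cspan A'" "h m \<notin> cspan (snd s)" "cinner (h m) w' = 1"
      using extend_orthonormal_functional[where h = h and w = "fst s", OF unbdd weak A pos]
      by (elim exE conjE) (rule that)
    then show "\<exists>s'. P (Suc n) s' \<and> Q n s s'"
      by (intro exI[of _ "(w', A')"]) (auto simp: P_def Q_def)
  qed
  then obtain f where P: "\<And>n. P n (f n)" and Q: "\<And>n. Q n (f n) (f (Suc n))" by blast
  define W where "W n = fst (f n)" for n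
  define B where "B n = snd (f n)" for n
  have W0: "W 0 = 0" using P[of 0] by (simp add: P_def W_def)
  have step: "norm (W (Suc n) - W n) \<le> \<epsilon> / 4 * (1 / 2) ^ n" for n
    using Q[of n] by (simp add: Q_def W_def)
  have orth: "cinner a (W (Suc n) - W n) = 0" if "a \<in> B n" for n a
    using Q[of n] that by (simp add: Q_def W_def B_def)
  have "B n \<subseteq> B (Suc n)" for n using Q[of n] by (simp add: Q_def B_def)
  then have mono: "B i \<subseteq> B j" if "i \<le> j" for i j using that by (rule lift_Suc_mono_le)
  have "\<forall>n. \<exists>m. h m \<in> cspan (B (Suc n)) \<and> h m \<notin> cspan (B n) \<and> cinner (h m) (W (Suc n)) = 1"
    using Q by (simp add: Q_def B_def W_def)
  then obtain \<sigma> where \<sigma>: "\<And>n. h (\<sigma> n) \<in> cspan (B (Suc n))" "\<And>n. h (\<sigma> n) \<notin> cspan (B n)"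
      "\<And>n. cinner (h (\<sigma> n)) (W (Suc n)) = 1"
    by metis
  have geom: "(\<lambda>n. \<epsilon> / 4 * (1 / 2) ^ n) sums (\<epsilon> / 4 * 2)"
    using sums_mult[OF geometric_sums[of "1/2::real"], of "\<epsilon> / 4"] by simp
  have summ: "summable (\<lambda>n. norm (W (Suc n) - W n))"
    by (rule summable_comparison_test[OF _ sums_summable[OF geom]]) (use step in simp)
  define w where "w = (\<Sum>n. W (Suc n) - W n)"
  have "(\<lambda>n. \<Sum>i<n. W (Suc i) - W i) \<longlonglongrightarrow> w"
    unfolding w_def by (rule summable_LIMSEQ[OF summable_norm_cancel[OF summ]])
  then have lim: "W \<longlonglongrightarrow> w" by (simp add: sum_lessThan_telescope W0)
  have "norm w \<le> (\<Sum>n. norm (W (Suc n) - W n))" unfolding w_def by (rule summable_norm[OF summ])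
  also have "\<dots> \<le> (\<Sum>n. \<epsilon> / 4 * (1 / 2) ^ n)"
    by (rule suminf_le[OF step summ sums_summable[OF geom]])
  also have "\<dots> = \<epsilon> / 4 * 2" using geom by (rule sums_unique[symmetric])
  finally have "norm w < \<epsilon>" using \<open>\<epsilon> > 0\<close> by simp
  moreover have one: "cinner (h (\<sigma> n)) w = 1" for n
  proof -
    \<comment> \<open>From stage \<open>Suc n\<close> on this value is frozen:
      \<open>h (\<sigma> n)\<close> lies in the span of \<open>B (Suc n)\<close>, to which all later
      corrections are orthogonal.\<close>
    have "cinner (h (\<sigma> n)) (W (Suc n + j)) = 1" for j
    proof (induction j)
      case 0
      then show ?case using \<sigma>(3) by simp
    next
      case (Suc j)
      have "h (\<sigma> n) \<in> cspan (B (Suc n + j))"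
        using \<sigma>(1) complex_vector.span_mono[OF mono[of "Suc n" "Suc n + j"]] by fastforce
      then have "cinner (h (\<sigma> n)) (W (Suc (Suc n + j)) - W (Suc n + j)) = 0"
        using orthogonal_cspan[of "B (Suc n + j)"] orth by blast
      then show ?case using Suc.IH by (simp add: cinner_diff_right)
    qed
    then have "(\<lambda>j. cinner (h (\<sigma> n)) (W (j + Suc n))) \<longlonglongrightarrow> 1" by (simp add: add.commute)
    moreover have "(\<lambda>j. cinner (h (\<sigma> n)) (W (j + Suc n))) \<longlonglongrightarrow> cinner (h (\<sigma> n)) w"
      by (intro tendsto_cinner tendsto_const LIMSEQ_ignore_initial_segment lim)
    ultimately show ?thesis using LIMSEQ_unique by blast
  qed
  moreover have "inj (\<lambda>n. h (\<sigma> n))"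
  proof (rule linorder_injI)
    fix i j :: nat assume "i < j"
    then have "cspan (B (Suc i)) \<subseteq> cspan (B j)" by (intro complex_vector.span_mono mono) simp
    then show "h (\<sigma> i) \<noteq> h (\<sigma> j)" using \<sigma>(1)[of i] \<sigma>(2)[of j] by auto
  qed
  then have "infinite (range (\<lambda>n. h (\<sigma> n)))" using finite_imageD by blast
  moreover have "range (\<lambda>n. h (\<sigma> n)) \<subseteq> h ` {n. cinner (h n) w = 1}" using one by auto
  ultimately show ?thesis using finite_subset by blast
qed

subsection \<open>Rank-one perturbations with infinitely many joint eigenvalues\<close>

text \<open>Banach--Steinhaus by Baire category: the closed sets \<open>A k\<close> cover the space,
  so one of them contains a ball, from which linearity spreads the bound.\<close>

lemma uniform_boundedness:
  fixes R :: "nat \<Rightarrow> 'a::chilbert_space \<Rightarrow> 'a"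
  assumes R: "\<And>n. bounded_clinear (R n)" and bdd: "\<And>x. \<exists>K. \<forall>n. norm (R n x) \<le> K"
  shows "\<exists>C. \<forall>n x. norm (R n x) \<le> C * norm x"
proof -
  define A where "A k = {x. \<forall>n. norm (R n x) \<le> real k}" for k
  have "closed (A k)" for k
  proof -
    have "A k = (\<Inter>n. {x. norm (R n x) \<le> real k})" by (auto simp: A_def)
    moreover have "closed {x. norm (R n x) \<le> real k}" for n
      by (intro closed_Collect_le continuous_on_norm continuous_on_const
          bounded_linear.continuous_on[OF bounded_clinear_imp_bounded_linear[OF R]] continuous_on_id)
    ultimately show ?thesis by (metis closed_INT)
  qed
  moreover have "x \<in> \<Union> (range A)" for x
  proof -
    obtain K where K: "\<forall>n. norm (R n x) \<le> K" using bdd by blast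
    obtain k where "K \<le> real k" using real_arch_simple by blast
    with K have "x \<in> A k" unfolding A_def by (blast intro: order_trans)
    then show ?thesis by blast
  qed
  then have "\<Union> (range A) = UNIV" by blast
  ultimately have "\<exists>k. interior (A k) \<noteq> {}"
    using Baire_category_alt[of "euclidean :: 'a topology" "range A"]
      completely_metrizable_space_euclidean by fastforce
  then obtain k x0 where "x0 \<in> interior (A k)" by blast
  then obtain r where r: "r > 0" "ball x0 r \<subseteq> A k" using mem_interior by blast
  \<comment> \<open>Scaled to length \<open>r / 2\<close>, the vector keeps \<open>x0\<close> plus
    it inside the ball; two values of norm at most \<open>k\<close> differ by at most
    \<open>2 * k\<close>.\<close>
  have "norm (R n x) \<le> (4 * real k / r) * norm x" for n x
  proof (cases "x = 0")
    case True
    then show ?thesis by (simp add: bounded_clinear_zero_apply[OF R])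
  next
    case False
    define c where "c = complex_of_real (r / 2 / norm x)"
    have "norm (c *\<^sub>C x) = r / 2" using False r(1) by (simp add: c_def norm_divide)
    then have "x0 + c *\<^sub>C x \<in> A k" "x0 \<in> A k" using r by (auto simp: dist_norm intro!: subsetD[OF r(2)])
    then have "norm (R n (x0 + c *\<^sub>C x) - R n x0) \<le> 2 * real k"
      using norm_triangle_ineq4[of "R n (x0 + c *\<^sub>C x)" "R n x0"] unfolding A_def
      by (smt (verit) mem_Collect_eq)
    then have "cmod c * norm (R n x) \<le> 2 * real k"
      by (simp add: bounded_clinear_add_apply[OF R] bounded_clinear_scale[OF R])
    then show ?thesis using False r(1) by (simp add: c_def norm_divide field_simps)
  qed
  then show ?thesis by blast
qed

text \<open>A common bound gives discs of one radius around all \<open>\<mu> n\<close> on which the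
  resolvent stays bounded, and the disc of a late \<open>\<mu> n\<close> covers a neighbourhood of
  \<zeta>. The contrapositive yields the blow-up along the sequence.\<close>

lemma pole_at_if_resolvent_bounded:
  fixes T :: "'a::chilbert_space \<Rightarrow> 'a"
  assumes T: "bounded_clinear T" and \<mu>: "filterlim \<mu> (at \<zeta>) sequentially"
    and spec: "\<And>n. \<mu> n \<notin> op_spectrum T"
    and bdd: "\<And>n x. norm (resolvent T (\<mu> n) x) \<le> C * norm x"
  shows "pole_at T \<zeta>"
proof -
  define C' where "C' = max C 1"
  have C': "C' > 0" "C \<le> C'" by (simp_all add: C'_def)
  have "\<forall>\<^sub>F n in sequentially. cmod (\<mu> n - \<zeta>) \<le> 1 / (4 * C')"
    by (rule eventually_compose_filterlim[OF eventually_at_cmod_le \<mu>]) (use C'(1) in simp)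
  then obtain n where n: "cmod (\<mu> n - \<zeta>) \<le> 1 / (4 * C')" by (auto simp: eventually_sequentially)
  have low: "norm x \<le> C' * norm (T x - \<mu> n *\<^sub>C x)" for x
    using bdd[of n "T x - \<mu> n *\<^sub>C x"] mult_right_mono[OF C'(2) norm_ge_zero[of "T x - \<mu> n *\<^sub>C x"]]
    by (simp add: resolvent_left[OF spec])
  have inv: "op_invertible (\<lambda>x. T x - \<mu> n *\<^sub>C x)" using spec by (simp add: op_spectrum_def)
  have "\<forall>\<^sub>F \<nu> in at \<zeta>. cmod (\<nu> - \<zeta>) \<le> 1 / (4 * C')"
    using C'(1) by (intro eventually_at_cmod_le) simp
  then have "\<forall>\<^sub>F \<nu> in at \<zeta>. \<nu> \<notin> op_spectrum T \<and>
      (\<forall>x. cmod (\<nu> - \<zeta>) ^ 0 * norm (resolvent T \<nu> x) \<le> (2 * C') * norm x)"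
  proof eventually_elim
    case (elim \<nu>)
    have "cmod (\<nu> - \<mu> n) \<le> cmod (\<nu> - \<zeta>) + cmod (\<mu> n - \<zeta>)"
      using norm_triangle_ineq4[of "\<nu> - \<zeta>" "\<mu> n - \<zeta>"] by simp
    also have "\<dots> \<le> 1 / (4 * C') + 1 / (4 * C')" using elim n by (rule add_mono)
    finally have near: "C' * cmod (\<nu> - \<mu> n) \<le> 1 / 2" using C'(1) by (simp add: field_simps)
    note * = resolvent_nearby[OF T inv less_imp_le[OF C'(1)] low near]
    have \<nu>: "\<nu> \<notin> op_spectrum T" using *(1) by (simp add: op_spectrum_def)
    moreover have "norm (resolvent T \<nu> x) \<le> 2 * C' * norm x" for x
      using *(2)[of "resolvent T \<nu> x"] by (simp add: resolvent_right[OF \<nu>])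
    ultimately show ?case by simp
  qed
  then show ?thesis unfolding pole_at_def by blast
qed

section \<open>Adjoint resolvents and the creation of joint eigenvalues\<close>

lemma not_in_spectrum_adjoint:
  fixes T :: "'a::chilbert_space \<Rightarrow> 'a"
  assumes "is_adjoint T S" "\<mu> \<notin> op_spectrum T"
  shows "cnj \<mu> \<notin> op_spectrum S"
  using assms(2) unfolding op_spectrum_adjoint[OF assms(1)] by (auto simp: image_iff)

lemma cinner_resolvent_adjoint:
  fixes T :: "'a::chilbert_space \<Rightarrow> 'a"
  assumes TS: "is_adjoint T S" and \<mu>: "\<mu> \<notin> op_spectrum T"
  shows "cinner (resolvent T \<mu> x) y = cinner x (resolvent S (cnj \<mu>) y)"
proof -
  let ?u = "resolvent T \<mu> x" and ?v = "resolvent S (cnj \<mu>) y"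
  have "cinner ?u (S ?v - cnj \<mu> *\<^sub>C ?v) = cinner (T ?u - \<mu> *\<^sub>C ?u) ?v"
    by (simp add: cinner_simps is_adjointD(3)[OF TS])
  then show ?thesis
    by (simp only: resolvent_right[OF \<mu>] resolvent_right[OF not_in_spectrum_adjoint[OF TS \<mu>]])
qed

lemma resolvent_adjoint_bound:
  fixes T :: "'a::chilbert_space \<Rightarrow> 'a"
  assumes TS: "is_adjoint T S" and \<mu>: "\<mu> \<notin> op_spectrum T"
    and bdd: "\<And>x. norm (resolvent S (cnj \<mu>) x) \<le> C * norm x"
  shows "norm (resolvent T \<mu> x) \<le> C * norm x"
proof (cases "resolvent T \<mu> x = 0")
  case True
  then show ?thesis using order_trans[OF norm_ge_zero bdd[of x]] by simp
next
  case False
  let ?u = "resolvent T \<mu> x"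
  have "(norm ?u)\<^sup>2 = cmod (cinner x (resolvent S (cnj \<mu>) ?u))"
    unfolding cinner_resolvent_adjoint[OF TS \<mu>, symmetric] cinner_same by (simp add: norm_power)
  also have "\<dots> \<le> norm x * norm (resolvent S (cnj \<mu>) ?u)" by (rule norm_cinner_le)
  also have "\<dots> \<le> norm x * (C * norm ?u)" by (intro mult_left_mono bdd) simp
  finally show ?thesis using False by (simp add: power2_eq_square mult_ac)
qed

text \<open>The pairing equals one exactly when the Sherman--Morrison denominator vanishes, so the
  resolvent vector of \<open>e\<close> becomes an eigenvector; by duality the resolvent vector of
  \<open>w\<close> for \<open>S\<close> becomes one of the perturbed adjoint.\<close>

lemma infinite_joint_eigenvalues_rank_one:
  fixes T :: "'a::chilbert_space \<Rightarrow> 'a"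
  assumes TS: "is_adjoint T S" and spec: "\<And>n::nat. \<mu> n \<notin> op_spectrum T"
    and inf: "infinite ((\<lambda>n. resolvent T (\<mu> n) e) ` {n. cinner (resolvent T (\<mu> n) e) w = 1})"
  shows "infinite (joint_eigenvalues (\<lambda>x. T x - rank_one e w x) (\<lambda>x. S x - rank_one w e x))"
    (is "infinite ?J")
proof -
  have "\<mu> n \<in> ?J" if n: "cinner (resolvent T (\<mu> n) e) w = 1" for n
  proof -
    let ?x = "resolvent T (\<mu> n) e" and ?y = "resolvent S (cnj (\<mu> n)) w"
    have "?x \<noteq> 0" using n by auto
    moreover have "T ?x - rank_one e w ?x = \<mu> n *\<^sub>C ?x"
      using resolvent_right[OF spec, of n e] n by (simp add: rank_one_def scaleC_one algebra_simps)
    moreover have "cinner e ?y = 1" using n by (simp add: cinner_resolvent_adjoint[OF TS spec])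
    then have y: "cinner ?y e = 1" using cinner_commute[of ?y e] by simp
    then have "?y \<noteq> 0" by auto
    moreover have "S ?y - rank_one w e ?y = cnj (\<mu> n) *\<^sub>C ?y"
      using resolvent_right[OF not_in_spectrum_adjoint[OF TS spec], of n w] y
      by (simp add: rank_one_def scaleC_one algebra_simps)
    ultimately show ?thesis unfolding joint_eigenvalues_def op_eigenvalue_def by blast
  qed
  \<comment> \<open>Infinitely many vectors force infinitely many points; infinitely many indices
    would not, as the sequence \<mu> may repeat values.\<close>
  then have "(\<lambda>n. resolvent T (\<mu> n) e) ` {n. cinner (resolvent T (\<mu> n) e) w = 1} \<subseteq>
      (\<lambda>z. resolvent T z e) ` ?J"
    by auto
  then show ?thesis using inf finite_surj by blast
qed

lemma closure_range_adjoint: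
  fixes T :: "'a::chilbert_space \<Rightarrow> 'a"
  assumes AB: "is_adjoint A B" and ker: "\<And>x. A x = 0 \<Longrightarrow> x = (0::'a)"
  shows "closure (range B) = UNIV"
proof (rule ccontr)
  note B = is_adjointD(2)[OF AB]
  assume ne: "closure (range B) \<noteq> UNIV"
  have sub: "csubspace (range B)"
  proof (rule complex_vector.subspaceI)
    show "0 \<in> range B" using bounded_clinear_zero_apply[OF B] by (metis rangeI)
    show "x + y \<in> range B" if "x \<in> range B" "y \<in> range B" for x y
      using that by (auto simp flip: bounded_clinear_add_apply[OF B])
    show "c *\<^sub>C x \<in> range B" if "x \<in> range B" for x c
      using that by (auto simp flip: bounded_clinear_scale[OF B])
  qed
  obtain z where z: "z \<noteq> 0" "\<forall>v\<in>closure (range B). cinner v z = 0"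
    using ex_orthogonal_vector[OF closure_csubspace[OF sub] closed_closure ne]
    by (elim exE conjE) (rule that)
  \<comment> \<open>Pairing this element of the range with \<open>z\<close> produces the square of
    \<open>norm (A z)\<close>.\<close>
  have "B (A z) \<in> closure (range B)" using closure_subset rangeI by (rule subsetD)
  then have "cinner (B (A z)) z = 0" using z(2) by (rule bspec[rotated])
  then have "cinner (A z) (A z) = 0" using is_adjointD(4)[OF AB, of "A z" z] by simp
  then have "A z = 0" by simp
  then show False using ker z(1) by blast
qed

text \<open>For \<open>z = ?B y\<close> the pairing is that of
  \<open>e + (\<mu> n - \<zeta>) ?h\<close> with \<open>y\<close>, small compared with
  \<open>norm ?h\<close> once \<open>\<mu> n\<close> is near \<zeta> and \<open>?h\<close> is long;
  such \<open>z\<close> are dense since the kernel is trivial. The threshold \<open>K\<close>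
  appears because the norms of the orbit may be unbounded without tending to infinity.\<close>

lemma resolvent_orbit_weakly_null:
  fixes T :: "'a::chilbert_space \<Rightarrow> 'a"
  assumes TS: "is_adjoint T S" and \<mu>: "filterlim \<mu> (at \<zeta>) sequentially"
    and spec: "\<And>n. \<mu> n \<notin> op_spectrum T" and ker: "\<And>x. T x = \<zeta> *\<^sub>C x \<Longrightarrow> x = 0" and "\<eta> > 0"
  shows "\<exists>N K. \<forall>n\<ge>N. K \<le> norm (resolvent T (\<mu> n) e) \<longrightarrow>
    cmod (cinner (resolvent T (\<mu> n) e) z) \<le> \<eta> * norm (resolvent T (\<mu> n) e)"
proof -
  let ?A = "\<lambda>x. T x - \<zeta> *\<^sub>C x" and ?B = "\<lambda>x. S x - cnj \<zeta> *\<^sub>C x"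
  have AB: "is_adjoint ?A ?B" by (rule is_adjoint_shift[OF TS])
  have "z \<in> closure (range ?B)" using closure_range_adjoint[OF AB] ker by auto
  then obtain y where y: "norm (z - ?B y) < \<eta> / 2"
    using \<open>\<eta> > 0\<close> unfolding closure_approachable by (metis (no_types, lifting) dist_commute dist_norm half_gt_zero imageE)
  define Y where "Y = norm y + 1"
  have Y: "Y > 0" "norm y \<le> Y" by (simp_all add: Y_def add_nonneg_pos)
  have "\<forall>\<^sub>F n in sequentially. cmod (\<mu> n - \<zeta>) \<le> \<eta> / (4 * Y)"
    by (rule eventually_compose_filterlim[OF eventually_at_cmod_le \<mu>]) (use \<open>\<eta> > 0\<close> Y(1) in simp)
  then obtain N where N: "\<And>n. n \<ge> N \<Longrightarrow> cmod (\<mu> n - \<zeta>) \<le> \<eta> / (4 * Y)"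
    by (auto simp: eventually_sequentially)
  have "cmod (cinner (resolvent T (\<mu> n) e) z) \<le> \<eta> * norm (resolvent T (\<mu> n) e)"
    if "n \<ge> N" and large: "norm e * Y / (\<eta> / 4) \<le> norm (resolvent T (\<mu> n) e)" for n
  proof -
    let ?h = "resolvent T (\<mu> n) e"
    have Ah: "?A ?h = e + (\<mu> n - \<zeta>) *\<^sub>C ?h"
      using resolvent_right[OF spec, of n e] by (simp add: algebra_simps complex_vector.scale_left_diff_distrib)
    have "cmod (cinner ?h (?B y)) = cmod (cinner (?A ?h) y)" by (simp add: is_adjointD(3)[OF AB])
    also have "\<dots> \<le> (norm e + cmod (\<mu> n - \<zeta>) * norm ?h) * Y"
      unfolding Ah using Y norm_triangle_ineq[of e "(\<mu> n - \<zeta>) *\<^sub>C ?h"]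
      by (intro order_trans[OF norm_cinner_le] mult_mono) auto
    also have "\<dots> = norm e * Y + cmod (\<mu> n - \<zeta>) * Y * norm ?h" by (simp add: algebra_simps)
    also have "\<dots> \<le> \<eta> / 4 * norm ?h + \<eta> / 4 * norm ?h"
    proof (rule add_mono)
      show "norm e * Y \<le> \<eta> / 4 * norm ?h" using large \<open>\<eta> > 0\<close> by (simp add: field_simps)
      have "cmod (\<mu> n - \<zeta>) * Y \<le> \<eta> / 4" using N[OF \<open>n \<ge> N\<close>] Y(1) by (simp add: field_simps)
      then show "cmod (\<mu> n - \<zeta>) * Y * norm ?h \<le> \<eta> / 4 * norm ?h" by (rule mult_right_mono) simp
    qed
    finally have 1: "cmod (cinner ?h (?B y)) \<le> \<eta> / 2 * norm ?h" by simp
    have "cmod (cinner ?h (z - ?B y)) \<le> norm ?h * norm (z - ?B y)" by (rule norm_cinner_le)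
    also have "\<dots> \<le> norm ?h * (\<eta> / 2)" using y by (intro mult_left_mono) auto
    finally have 2: "cmod (cinner ?h (z - ?B y)) \<le> \<eta> / 2 * norm ?h" by (simp add: mult.commute)
    have "cinner ?h z = cinner ?h (?B y) + cinner ?h (z - ?B y)" by (simp add: cinner_diff_right)
    then have "cmod (cinner ?h z) \<le> cmod (cinner ?h (?B y)) + cmod (cinner ?h (z - ?B y))"
      by (simp only: norm_triangle_ineq)
    with 1 2 show ?thesis by (simp add: algebra_simps)
  qed
  then show ?thesis by blast
qed

text \<open>Uniform boundedness condenses the unbounded resolvents into one vector \<open>e\<close>
  with unbounded orbit. Dropping finitely many indices keeps the orbit unbounded, as the greedy
  construction demands.\<close>

lemma ex_rank_one_infinite_joint_eigenvalues:
  fixes T :: "'a::chilbert_space \<Rightarrow> 'a"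
  assumes TS: "is_adjoint T S" and \<mu>: "filterlim \<mu> (at \<zeta>) sequentially"
    and spec: "\<And>n. \<mu> n \<notin> op_spectrum T" and ker: "\<And>x. T x = \<zeta> *\<^sub>C x \<Longrightarrow> x = 0"
    and unbdd: "\<nexists>C. \<forall>n x. norm (resolvent T (\<mu> n) x) \<le> C * norm x" and "\<epsilon> > 0"
  shows "\<exists>e w. norm e * norm w \<le> \<epsilon> \<and>
    infinite (joint_eigenvalues (\<lambda>x. T x - rank_one e w x) (\<lambda>x. S x - rank_one w e x))"
proof -
  obtain e where e: "\<nexists>K. \<forall>n. norm (resolvent T (\<mu> n) e) \<le> K"
    using uniform_boundedness[of "\<lambda>n. resolvent T (\<mu> n)"] bounded_clinear_resolvent[OF spec] unbdd
    by blast
  let ?h = "\<lambda>n. resolvent T (\<mu> n) e"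
  have 1: "\<exists>n\<ge>N. K \<le> norm (?h n)" for N K
  proof (rule ccontr)
    assume *: "\<not> ?thesis"
    have "norm (?h n) \<le> max K (Max (insert 0 ((\<lambda>n. norm (?h n)) ` {..<N})))" for n
    proof (cases "n < N")
      case True
      then have "norm (?h n) \<le> Max (insert 0 ((\<lambda>n. norm (?h n)) ` {..<N}))" by (intro Max_ge) auto
      then show ?thesis by simp
    next
      case False
      then have "norm (?h n) \<le> K" using * by (meson linear not_less)
      then show ?thesis by simp
    qed
    then show False using e by blast
  qed
  have "norm e + 1 > 0" by (simp add: add_nonneg_pos)
  then have "\<epsilon> / (norm e + 1) > 0" using \<open>\<epsilon> > 0\<close> by simp
  then obtain w where w: "norm w < \<epsilon> / (norm e + 1)" "infinite (?h ` {n. cinner (?h n) w = 1})"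
    using ex_small_functional[of ?h, OF 1] resolvent_orbit_weakly_null[OF TS \<mu> spec ker] by blast
  have "norm e * norm w \<le> (norm e + 1) * norm w" by (intro mult_right_mono) auto
  also have "\<dots> \<le> \<epsilon>" using w(1) \<open>norm e + 1 > 0\<close> by (simp add: field_simps)
  finally show ?thesis using infinite_joint_eigenvalues_rank_one[OF TS spec w(2)] by blast
qed

subsection \<open>Small finite-rank perturbations with an invariant half-space\<close>

text \<open>The plane minus finitely many points is connected, so off its frontier \<open>A\<close>
  is everything or nothing; boundedness excludes the former.\<close>

lemma finite_if_finite_frontier:
  fixes A :: "complex set"
  assumes "bounded A" "finite (frontier A)"
  shows "finite A"
proof -
  have "connected (- frontier A)"
    using assms(2) by (intro path_connected_imp_connected path_connected_complement_countable)
      (auto simp: countable_finite)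
  moreover have "- frontier A \<inter> frontier A = {}" by blast
  ultimately have "- frontier A \<inter> A = {} \<or> - frontier A - A = {}"
    using connected_Int_frontier by blast
  moreover have "- frontier A - A \<noteq> {}"
  proof
    assume "- frontier A - A = {}"
    then have "UNIV = frontier A \<union> A" by blast
    then have "bounded (UNIV :: complex set)"
      using assms by (metis bounded_Un finite_imp_bounded)
    then show False by simp
  qed
  ultimately have "A \<subseteq> frontier A" by blast
  then show ?thesis using assms(2) finite_subset by blast
qed

text \<open>Source of the uniform rank bound: at most \<open>card B\<close> dimensions are spent on
  trivialising a kernel and one more on the rank-one operator that creates the eigenvalues. Each of
  the two stages gets \<epsilon>/2.\<close>

lemma ex_perturbation_half_space:
  fixes T :: "'a::chilbert_space \<Rightarrow> 'a"
  assumes TS: "is_adjoint T S" and \<mu>: "filterlim \<mu> (at \<zeta>) sequentially"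
    and spec: "\<And>n. \<mu> n \<notin> op_spectrum T" and npole: "\<not> pole_at T \<zeta>"
    and B: "{x. T x = \<zeta> *\<^sub>C x} \<subseteq> cspan B" "finite B" and "\<epsilon> > 0"
  shows "\<exists>F D. bounded_clinear F \<and> finite D \<and> card D \<le> card B + 1 \<and> range F \<subseteq> cspan D \<and>
    (\<forall>x. norm (F x) \<le> \<epsilon> * norm x) \<and> has_half_space (\<lambda>x. T x - F x)"
proof -
  have \<epsilon>2: "\<epsilon> / 2 > 0" using \<open>\<epsilon> > 0\<close> by simp
  obtain F G D where FG: "is_adjoint F G" "\<forall>n. \<mu> n \<notin> op_spectrum (\<lambda>x. T x - F x)"
      "\<not> pole_at (\<lambda>x. T x - F x) \<zeta>" "finite D" "card D \<le> card B" "range F \<subseteq> cspan D"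
      "\<forall>x. norm (F x) \<le> \<epsilon> / 2 * norm x"
      "(\<forall>x. T x - F x = \<zeta> *\<^sub>C x \<longrightarrow> x = 0) \<or> (\<forall>x. S x - G x = cnj \<zeta> *\<^sub>C x \<longrightarrow> x = 0)"
    using ex_perturbation_trivial_kernel[where \<mu> = \<mu>, OF TS \<mu> spec npole B \<epsilon>2]
    by (elim exE conjE) (rule that)
  define T1 where "T1 x = T x - F x" for x
  define S1 where "S1 x = S x - G x" for x
  have TS1: "is_adjoint T1 S1" unfolding T1_def S1_def by (rule is_adjoint_diff[OF TS FG(1)])
  have spec1: "\<mu> n \<notin> op_spectrum T1" for n using FG(2) unfolding T1_def by blast
  have npole1: "\<not> pole_at T1 \<zeta>" using FG(3) unfolding T1_def by blast
  have unbdd: "\<nexists>C. \<forall>n x. norm (resolvent T1 (\<mu> n) x) \<le> C * norm x"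
    using pole_at_if_resolvent_bounded[OF is_adjointD(1)[OF TS1] \<mu> spec1] npole1 by blast
  have "\<exists>e w. norm e * norm w \<le> \<epsilon> / 2 \<and>
      infinite (joint_eigenvalues (\<lambda>x. T1 x - rank_one e w x) (\<lambda>x. S1 x - rank_one w e x))"
    using FG(8)
  proof
    assume "\<forall>x. T x - F x = \<zeta> *\<^sub>C x \<longrightarrow> x = 0"
    then have "x = 0" if "T1 x = \<zeta> *\<^sub>C x" for x using that by (simp add: T1_def)
    then show ?thesis
      using ex_rank_one_infinite_joint_eigenvalues[OF TS1 \<mu> spec1 _ unbdd \<epsilon>2] by blast
  next
    \<comment> \<open>Here the argument runs for the adjoint along the conjugate sequence. The
      operator found is the adjoint of the wanted one, so \<open>e\<close> and \<open>w\<close>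
      swap.\<close>
    assume "\<forall>x. S x - G x = cnj \<zeta> *\<^sub>C x \<longrightarrow> x = 0"
    then have ker: "x = 0" if "S1 x = cnj \<zeta> *\<^sub>C x" for x using that by (simp add: S1_def)
    have "\<forall>\<^sub>F n in sequentially. \<mu> n \<noteq> \<zeta>" and "\<mu> \<longlonglongrightarrow> \<zeta>"
      using \<mu> by (simp_all add: filterlim_at)
    then have lim: "filterlim (\<lambda>n. cnj (\<mu> n)) (at (cnj \<zeta>)) sequentially"
      by (auto simp: filterlim_at intro: tendsto_cnj)
    have "\<nexists>C. \<forall>n x. norm (resolvent S1 (cnj (\<mu> n)) x) \<le> C * norm x"
      using unbdd resolvent_adjoint_bound[OF TS1 spec1] by blast
    from ex_rank_one_infinite_joint_eigenvalues[OF is_adjoint_sym[OF TS1] lim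
        not_in_spectrum_adjoint[OF TS1 spec1] ker this \<epsilon>2]
    obtain e w where "norm e * norm w \<le> \<epsilon> / 2"
      "infinite (joint_eigenvalues (\<lambda>x. S1 x - rank_one e w x) (\<lambda>x. T1 x - rank_one w e x))"
      by blast
    then show ?thesis
      using infinite_joint_eigenvalues_sym by (metis mult.commute)
  qed
  then obtain e w where ew: "norm e * norm w \<le> \<epsilon> / 2"
      "infinite (joint_eigenvalues (\<lambda>x. T1 x - rank_one e w x) (\<lambda>x. S1 x - rank_one w e x))"
    by blast
  have "has_half_space (\<lambda>x. T1 x - rank_one e w x)"
    by (rule has_half_space_joint_eigenvalues[OF is_adjoint_diff[OF TS1 is_adjoint_rank_one] ew(2)])
  moreover have "(\<lambda>x. T1 x - rank_one e w x) = (\<lambda>x. T x - (F x + rank_one e w x))"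
    by (simp add: T1_def diff_diff_eq)
  ultimately have "has_half_space (\<lambda>x. T x - (F x + rank_one e w x))" by simp
  moreover have "bounded_clinear (\<lambda>x. F x + rank_one e w x)"
    by (intro bounded_clinear_add bounded_clinear_rank_one is_adjointD(1)[OF FG(1)])
  moreover have "range (\<lambda>x. F x + rank_one e w x) \<subseteq> cspan (insert e D)"
  proof
    fix y assume "y \<in> range (\<lambda>x. F x + rank_one e w x)"
    then obtain x where "y = F x + rank_one e w x" by blast
    moreover have "F x \<in> cspan (insert e D)"
      using FG(6) complex_vector.span_mono[of D "insert e D"] by blast
    moreover have "rank_one e w x \<in> cspan (insert e D)"
      unfolding rank_one_def by (intro complex_vector.span_scale complex_vector.span_base) simp
    ultimately show "y \<in> cspan (insert e D)" by (simp add: complex_vector.span_add)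
  qed
  moreover have "finite (insert e D)" "card (insert e D) \<le> card B + 1"
    using FG(4,5) by (simp_all add: card_insert_if)
  moreover have "norm (F x + rank_one e w x) \<le> \<epsilon> * norm x" for x
  proof -
    have "norm (rank_one e w x) \<le> \<epsilon> / 2 * norm x"
      using order_trans[OF norm_rank_one_le mult_right_mono[OF ew(1) norm_ge_zero]] .
    then show ?thesis
      using norm_triangle_ineq[of "F x" "rank_one e w x"] FG(7)[rule_format, of x] by linarith
  qed
  ultimately show ?thesis
    by (intro exI[of _ "\<lambda>x. F x + rank_one e w x"] exI[of _ "insert e D"] conjI allI)
qed

lemma ex_bounded_rank_perturbation:
  fixes T :: "'a::chilbert_space \<Rightarrow> 'a"
  assumes inf: "\<not> cfinite_dim (UNIV :: 'a set)" and TS: "is_adjoint T S"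
    and eig: "\<And>z. z \<in> frontier (op_spectrum T) \<Longrightarrow> op_eigenvalue T z"
    and eig': "\<And>z. z \<in> frontier (op_spectrum S) \<Longrightarrow> op_eigenvalue S z"
  shows "\<exists>m::nat. \<forall>\<epsilon>>0. \<exists>F D. bounded_clinear F \<and> finite D \<and> card D \<le> m \<and> range F \<subseteq> cspan D \<and>
    (\<forall>x. norm (F x) \<le> \<epsilon> * norm x) \<and> has_half_space (\<lambda>x. T x - F x)"
proof (cases "has_half_space T")
  case True
  have "bounded_clinear (\<lambda>x::'a. 0::'a)" "range (\<lambda>x::'a. 0::'a) \<subseteq> cspan {}"
    by (simp_all add: bounded_clinear_zero)
  with True show ?thesis
    by (intro exI[of _ 0] allI impI exI[of _ "\<lambda>x. 0"] exI[of _ "{}"]) simp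
next
  case False
  note T = is_adjointD(1)[OF TS]
  \<comment> \<open>Spectrum and frontier of \<open>S\<close> are the conjugates of those of
    \<open>T\<close>, so the two eigenvalue hypotheses meet at the same points.\<close>
  have "frontier (op_spectrum T) \<subseteq> joint_eigenvalues T S"
    unfolding joint_eigenvalues_def
    using eig eig' by (auto simp: op_spectrum_adjoint[OF TS] frontier_cnj_image)
  then have "finite (frontier (op_spectrum T))"
    using has_half_space_joint_eigenvalues[OF TS] False finite_subset by blast
  then have fin: "finite (op_spectrum T)"
    using finite_if_finite_frontier compact_op_spectrum[OF T] compact_imp_bounded by blast
  obtain \<zeta> where npole: "\<not> pole_at T \<zeta>"
    using ex_infinite_dim_eigenspace[OF inf T fin] has_half_space_eigenspace[OF T] False by blast
  obtain B where B: "{x. T x = \<zeta> *\<^sub>C x} \<subseteq> cspan B" "finite B"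
    using has_half_space_eigenspace[OF T] False unfolding cfinite_dim_def by blast
  \<comment> \<open>A finite spectrum has no limit points, so \<zeta> is approached from outside
    it.\<close>
  have "\<zeta> islimpt (op_spectrum T \<union> - op_spectrum T)" by (simp add: Compl_partition)
  then have "\<zeta> islimpt (- op_spectrum T)"
    using islimpt_finite[OF fin] unfolding islimpt_Un by blast
  then obtain \<mu> where \<mu>: "\<And>n::nat. \<mu> n \<in> - op_spectrum T - {\<zeta>}" "\<mu> \<longlonglongrightarrow> \<zeta>"
    unfolding islimpt_sequential by blast
  then have "filterlim \<mu> (at \<zeta>) sequentially" "\<And>n. \<mu> n \<notin> op_spectrum T"
    by (auto simp: filterlim_at)
  then show ?thesis
    using ex_perturbation_half_space[where \<mu> = \<mu>, OF TS _ _ npole B] by blast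
qed

theorem proposition3p4:
  fixes T :: "'a::chilbert_space \<Rightarrow> 'a"
  assumes "\<not> cfinite_dim (UNIV :: 'a set)"
    and "bounded_clinear T"
    and "\<forall>z \<in> frontier (op_spectrum T). op_eigenvalue T z"
    and "\<forall>z \<in> frontier (op_spectrum (cadjoint T)). op_eigenvalue (cadjoint T) z"
  shows "\<exists>r::nat. \<forall>\<epsilon>::real. \<epsilon> > 0 \<longrightarrow>
    (\<exists>F :: 'a \<Rightarrow> 'a. bounded_clinear F \<and> finite_rank F \<and> op_rank F = r \<and> onorm F < \<epsilon> \<and>
      (\<exists>M :: 'a set. csubspace M \<and> closed M \<and> op_invariant (\<lambda>x. T x - F x) M \<and>
        \<not> cfinite_dim M \<and> \<not> cfinite_codim M))"
proof -
  obtain S where TS: "is_adjoint T S" using ex_adjoint[OF assms(2)] ..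
  obtain m :: nat where m: "\<forall>\<epsilon>>0. \<exists>F D. bounded_clinear F \<and> finite D \<and> card D \<le> m \<and>
      range F \<subseteq> cspan D \<and> (\<forall>x. norm (F x) \<le> \<epsilon> * norm x) \<and> has_half_space (\<lambda>x. T x - F x)"
    using ex_bounded_rank_perturbation[OF assms(1) TS] assms(3,4) unfolding cadjoint_eq[OF TS] by blast
  have "\<exists>F. bounded_clinear F \<and> finite_rank F \<and> op_rank F \<le> m \<and>
      onorm F \<le> 1 / real (Suc k) \<and> has_half_space (\<lambda>x. T x - F x)" for k
  proof -
    have pos: "1 / real (Suc k) > 0" by simp
    obtain F D where F: "bounded_clinear F" "finite D" "card D \<le> m" "range F \<subseteq> cspan D"
        "\<forall>x. norm (F x) \<le> 1 / real (Suc k) * norm x" "has_half_space (\<lambda>x. T x - F x)"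
      using m[rule_format, OF pos] by (elim exE conjE) (rule that)
    have "op_rank F \<le> m"
      unfolding op_rank_def using complex_vector.dim_le_card[OF F(4,2)] F(3) by (rule le_trans)
    moreover have "finite_rank F" unfolding finite_rank_def cfinite_dim_def using F(2,4) by blast
    moreover have "onorm F \<le> 1 / real (Suc k)" using F(5) by (intro onorm_bound) auto
    ultimately show ?thesis using F(1,6) by blast
  qed
  then obtain G where G: "\<And>k::nat. bounded_clinear (G k)" "\<And>k. finite_rank (G k)"
      "\<And>k. op_rank (G k) \<le> m" "\<And>k. onorm (G k) \<le> 1 / real (Suc k)"
      "\<And>k. has_half_space (\<lambda>x. T x - G k x)"
    by metis
  have "finite ((\<lambda>k. op_rank (G k)) ` UNIV)"
    by (rule finite_subset[of _ "{..m}"]) (use G(3) in auto)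
  \<comment> \<open>This rank recurs beyond every index, hence with norm below every given
    bound.\<close>
  then obtain k0 where inf: "infinite {k. op_rank (G k) = op_rank (G k0)}"
    using pigeonhole_infinite[OF infinite_UNIV_nat, of "\<lambda>k. op_rank (G k)"] by auto
  show ?thesis
  proof (intro exI[of _ "op_rank (G k0)"] allI impI)
    fix \<epsilon> :: real assume "\<epsilon> > 0"
    then obtain N where N: "inverse (real (Suc N)) < \<epsilon>" using reals_Archimedean by blast
    obtain k where k: "k \<ge> N" "op_rank (G k) = op_rank (G k0)"
      using inf unfolding infinite_nat_iff_unbounded_le by blast
    have "1 / real (Suc k) \<le> inverse (real (Suc N))" using k(1) by (simp add: field_simps)
    then have "onorm (G k) < \<epsilon>" using G(4)[of k] N by linarith
    then show "\<exists>F. bounded_clinear F \<and> finite_rank F \<and> op_rank F = op_rank (G k0) \<and> onorm F < \<epsilon> \<and>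
      (\<exists>M. csubspace M \<and> closed M \<and> op_invariant (\<lambda>x. T x - F x) M \<and>
        \<not> cfinite_dim M \<and> \<not> cfinite_codim M)"
      using G(1,2,5)[of k] k(2) unfolding has_half_space_def by blast
  qed
qed

end
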